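(* Let $(\mu,\mu')$ be a regular couple of characters of $\mathcal O_r^\times$ and let $\Pi_{\mu,\mu'}$ be the associated principal split representation of $GL(2,\mathcal O_r)$. For every $0\le i\le r-1$ and $\alpha,\delta\in\mathcal O_r^\times$ with $\alpha-\delta\in\varpi^i\mathcal O_r^\times$, the character of $\Pi_{\mu,\mu'}$ at $D_{i,\alpha,\delta}=\begin{pmatrix}\alpha&0\\0&\delta\end{pmatrix}$ is $$\mathrm{tr}(D_{i,\alpha,\delta}|_{\Pi_{\mu,\mu'}})=q^i\big(\mu(\alpha)\mu'(\delta)+\mu'(\alpha)\mu(\delta)\big).$$
   Context: $F$ is a non-archimedean local field with ring of integers $\mathcal O$, uniformizer $\varpi$, residue field of cardinality $q$ and characteristic $p\neq2$. $r\ge2$ is an even integer, $l=r/2$, $\mathcal O_r=\mathcal O/\varpi^r\mathcal O$, $G^{(r)}=GL(2,\mathcal O_r)$. A couple $(\mu,\mu')$ of characters $\mathcal O_r^\times\to\mathbb C^\times$ is called regular if the restriction of $\mu\mu'^{-1}$ to $1+\varpi^l\mathcal O_r$ is primitive, i.e. nontrivial on $1+\varpi^{r-1}\mathcal O_r$. Let $T=\left\{\begin{pmatrix}s_1&\varpi^ly\\ \varpi^lz&s_2\end{pmatrix}: s_1,s_2\in\mathcal O_r^\times,\ y,z\in\mathcal O_r\right\}\subset G^{(r)}$. For a regular couple, $\mu\boxtimes\mu'$ is the one-dimensional representation of $T$ given by $(\mu\boxtimes\mu')\begin{pmatrix}s_1&\varpi^ly\\ \varpi^lz&s_2\end{pmatrix}=\mu(s_1)\mu'(s_2)$,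 and $\Pi_{\mu,\mu'}=\mathrm{Ind}_T^{G^{(r)}}(\mu\boxtimes\mu')$. *)

theory Defs
  imports Complex_Main "HOL-Algebra.Algebra" "HOL-Library.Function_Algebras"
begin

section \<open>Non-archimedean local fields\<close>

text \<open>
  \<open>frac_ideal F v n\<close> consists of the elements of valuation at least \<open>n\<close>, the valuation of zero
  being infinite. The value of the integer-valued function \<open>v\<close> at zero is never used.
\<close>

definition frac_ideal :: "('a, 'b) ring_scheme \<Rightarrow> ('a \<Rightarrow> int) \<Rightarrow> int \<Rightarrow> 'a set" where
  "frac_ideal F v n = {x \<in> carrier F. x = \<zero>\<^bsub>F\<^esub> \<or> n \<le> v x}"

definition int_ring :: "('a, 'b) ring_scheme \<Rightarrow> ('a \<Rightarrow> int) \<Rightarrow> ('a, 'b) ring_scheme" where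
  "int_ring F v = F\<lparr>carrier := frac_ideal F v 0\<rparr>"

definition residue_field :: "('a, 'b) ring_scheme \<Rightarrow> ('a \<Rightarrow> int) \<Rightarrow> 'a set ring" where
  "residue_field F v = int_ring F v Quot frac_ideal F v 1"

text \<open>
  A field that is complete for a normalised discrete valuation and has finite residue field.
\<close>

locale nonarch_local_field = field F for F (structure) +
  fixes v :: "'a \<Rightarrow> int"
  assumes v_mult:
      "\<lbrakk>x \<in> carrier F - {\<zero>}; y \<in> carrier F - {\<zero>}\<rbrakk> \<Longrightarrow> v (x \<otimes> y) = v x + v y"
    and v_add:
      "\<lbrakk>x \<in> carrier F - {\<zero>}; y \<in> carrier F - {\<zero>}; x \<oplus> y \<noteq> \<zero>\<rbrakk>
        \<Longrightarrow> min (v x) (v y) \<le> v (x \<oplus> y)"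
    and v_normalised: "\<exists>x \<in> carrier F - {\<zero>}. v x = 1"
    and v_complete:
      "\<lbrakk>\<And>n. s n \<in> carrier F;
        \<And>N. \<exists>M. \<forall>m\<ge>M. \<forall>n\<ge>M. s m \<ominus> s n \<in> frac_ideal F v N\<rbrakk>
        \<Longrightarrow> \<exists>x \<in> carrier F. \<forall>N. \<exists>M. \<forall>n\<ge>M. s (n :: nat) \<ominus> x \<in> frac_ideal F v N"
    and finite_residue_field: "finite (carrier (residue_field F v))"

definition uniformizer :: "('a, 'b) ring_scheme \<Rightarrow> ('a \<Rightarrow> int) \<Rightarrow> 'a \<Rightarrow> bool" where
  "uniformizer F v \<pi> \<longleftrightarrow> \<pi> \<in> carrier F - {\<zero>\<^bsub>F\<^esub>} \<and> v \<pi> = 1"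

definition ring_char :: "('a, 'b) ring_scheme \<Rightarrow> nat" where
  "ring_char R = Gcd {n :: nat. [n] \<cdot>\<^bsub>R\<^esub> \<one>\<^bsub>R\<^esub> = \<zero>\<^bsub>R\<^esub>}"

text \<open>The ideal generated by \<open>\<pi> ^ r\<close> in the ring of integers, the quotient by it, and the class
  of \<open>\<pi>\<close> in this quotient.\<close>

definition pi_ideal :: "('a, 'b) ring_scheme \<Rightarrow> ('a \<Rightarrow> int) \<Rightarrow> 'a \<Rightarrow> nat \<Rightarrow> 'a set" where
  "pi_ideal F v \<pi> r = PIdl\<^bsub>int_ring F v\<^esub> (\<pi> [^]\<^bsub>int_ring F v\<^esub> r)"

definition trunc_ring :: "('a, 'b) ring_scheme \<Rightarrow> ('a \<Rightarrow> int) \<Rightarrow> 'a \<Rightarrow> nat \<Rightarrow> 'a set ring" where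
  "trunc_ring F v \<pi> r = int_ring F v Quot pi_ideal F v \<pi> r"

definition trunc_pi :: "('a, 'b) ring_scheme \<Rightarrow> ('a \<Rightarrow> int) \<Rightarrow> 'a \<Rightarrow> nat \<Rightarrow> 'a set" where
  "trunc_pi F v \<pi> r = pi_ideal F v \<pi> r +>\<^bsub>int_ring F v\<^esub> \<pi>"


section \<open>Characters of the unit group\<close>

definition C_star :: "complex monoid" where
  "C_star = \<lparr>carrier = UNIV - {0}, monoid.mult = (*), one = 1\<rparr>"

definition unit_char :: "('a, 'b) ring_scheme \<Rightarrow> ('a \<Rightarrow> complex) \<Rightarrow> bool" where
  "unit_char R \<mu> \<longleftrightarrow> \<mu> \<in> hom (units_of R) C_star"

text \<open>
  Here \<open>R\<close> stands for the truncated ring of length \<open>r\<close> and \<open>t\<close> for the class of the uniformizer.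
  Since \<open>r - 1 \<ge> r div 2\<close>, the set \<open>1 + t ^ (r - 1) R\<close> lies in \<open>1 + t ^ (r div 2) R\<close>, so that
  primitivity of the restriction to the latter is nontriviality on the former.
\<close>

definition regular_couple ::
  "('a, 'b) ring_scheme \<Rightarrow> 'a \<Rightarrow> nat \<Rightarrow> ('a \<Rightarrow> complex) \<Rightarrow> ('a \<Rightarrow> complex) \<Rightarrow> bool" where
  "regular_couple R t r \<mu> \<mu>' \<longleftrightarrow> unit_char R \<mu> \<and> unit_char R \<mu>' \<and>
     (\<exists>x \<in> {\<one>\<^bsub>R\<^esub> \<oplus>\<^bsub>R\<^esub> t [^]\<^bsub>R\<^esub> (r - 1) \<otimes>\<^bsub>R\<^esub> y | y. y \<in> carrier R}.
        \<mu> x * inverse (\<mu>' x) \<noteq> 1)"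


section \<open>The group GL(2) and its subgroup T\<close>

datatype 'a mat2 = Mat2 (e11: 'a) (e12: 'a) (e21: 'a) (e22: 'a)

definition M2 :: "('a, 'b) ring_scheme \<Rightarrow> 'a mat2 monoid" where
  "M2 R = \<lparr>carrier = {Mat2 a b c d | a b c d.
              a \<in> carrier R \<and> b \<in> carrier R \<and> c \<in> carrier R \<and> d \<in> carrier R},
     monoid.mult = (\<lambda>A B. Mat2
       (e11 A \<otimes>\<^bsub>R\<^esub> e11 B \<oplus>\<^bsub>R\<^esub> e12 A \<otimes>\<^bsub>R\<^esub> e21 B)
       (e11 A \<otimes>\<^bsub>R\<^esub> e12 B \<oplus>\<^bsub>R\<^esub> e12 A \<otimes>\<^bsub>R\<^esub> e22 B)
       (e21 A \<otimes>\<^bsub>R\<^esub> e11 B \<oplus>\<^bsub>R\<^esub> e22 A \<otimes>\<^bsub>R\<^esub> e21 B)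
       (e21 A \<otimes>\<^bsub>R\<^esub> e12 B \<oplus>\<^bsub>R\<^esub> e22 A \<otimes>\<^bsub>R\<^esub> e22 B)),
     one = Mat2 \<one>\<^bsub>R\<^esub> \<zero>\<^bsub>R\<^esub> \<zero>\<^bsub>R\<^esub> \<one>\<^bsub>R\<^esub>\<rparr>"

definition GL2 :: "('a, 'b) ring_scheme \<Rightarrow> 'a mat2 monoid" where
  "GL2 R = units_of (M2 R)"

definition T_subgroup :: "('a, 'b) ring_scheme \<Rightarrow> 'a \<Rightarrow> nat \<Rightarrow> 'a mat2 set" where
  "T_subgroup R t l =
     {Mat2 s\<^sub>1 (t [^]\<^bsub>R\<^esub> l \<otimes>\<^bsub>R\<^esub> y) (t [^]\<^bsub>R\<^esub> l \<otimes>\<^bsub>R\<^esub> z) s\<^sub>2 | s\<^sub>1 s\<^sub>2 y z.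
        s\<^sub>1 \<in> Units R \<and> s\<^sub>2 \<in> Units R \<and> y \<in> carrier R \<and> z \<in> carrier R}"

definition box_char :: "('a \<Rightarrow> complex) \<Rightarrow> ('a \<Rightarrow> complex) \<Rightarrow> 'a mat2 \<Rightarrow> complex" where
  "box_char \<mu> \<mu>' A = \<mu> (e11 A) * \<mu>' (e22 A)"


section \<open>Traces and induced representations\<close>

text \<open>
  The trace of an endomorphism \<open>A\<close> of a finite-dimensional subspace \<open>V\<close>: the sum of the diagonal
  entries of its matrix in a basis of \<open>V\<close>.
\<close>

definition (in vector_space) trace_on :: "'b set \<Rightarrow> ('b \<Rightarrow> 'b) \<Rightarrow> 'a" where
  "trace_on V A =
     (let B = (SOME B. independent B \<and> span B = V) in \<Sum>b\<in>B. representation B (A b) b)"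

definition cfun_scale :: "complex \<Rightarrow> ('g \<Rightarrow> complex) \<Rightarrow> 'g \<Rightarrow> complex" where
  "cfun_scale c f = (\<lambda>x. c * f x)"

global_interpretation cfun: vector_space cfun_scale
  by unfold_locales (auto simp: cfun_scale_def fun_eq_iff algebra_simps)

text \<open>
  The representation of \<open>G\<close> induced from the one-dimensional representation \<open>\<chi>\<close> of the subgroup
  \<open>H\<close>: functions \<open>f\<close> on \<open>G\<close> with \<open>f (h x) = \<chi> h f x\<close>, on which \<open>G\<close> acts by right translation.
  A function on \<open>G\<close> is represented by its extension by zero to the whole type.
\<close>

definition ind_space :: "('g, 'm) monoid_scheme \<Rightarrow> 'g set \<Rightarrow> ('g \<Rightarrow> complex) \<Rightarrow> ('g \<Rightarrow> complex) set"
  where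
  "ind_space G H \<chi> = {f. (\<forall>x. x \<notin> carrier G \<longrightarrow> f x = 0) \<and>
     (\<forall>h \<in> H. \<forall>x \<in> carrier G. f (h \<otimes>\<^bsub>G\<^esub> x) = \<chi> h * f x)}"

definition ind_action :: "('g, 'm) monoid_scheme \<Rightarrow> 'g \<Rightarrow> ('g \<Rightarrow> complex) \<Rightarrow> 'g \<Rightarrow> complex" where
  "ind_action G g f = (\<lambda>x. if x \<in> carrier G then f (x \<otimes>\<^bsub>G\<^esub> g) else 0)"

definition ind_trace ::
  "('g, 'm) monoid_scheme \<Rightarrow> 'g set \<Rightarrow> ('g \<Rightarrow> complex) \<Rightarrow> 'g \<Rightarrow> complex" where
  "ind_trace G H \<chi> g = cfun.trace_on (ind_space G H \<chi>) (ind_action G g)"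

text \<open>The trace of \<open>g\<close> on the principal split representation attached to \<open>\<mu>\<close> and \<open>\<mu>'\<close>.\<close>

definition principal_split_trace ::
  "('a, 'b) ring_scheme \<Rightarrow> 'a \<Rightarrow> nat \<Rightarrow> ('a \<Rightarrow> complex) \<Rightarrow> ('a \<Rightarrow> complex) \<Rightarrow> 'a mat2 \<Rightarrow> complex" where
  "principal_split_trace R t r \<mu> \<mu>' g =
     ind_trace (GL2 R) (T_subgroup R t (r div 2)) (box_char \<mu> \<mu>') g"

end

theory Submission
  imports Defs
begin

text \<open>
  By the character formula for an induced representation, the trace at \<open>D = diag(\<alpha>, \<delta>)\<close> is the sum
  of \<open>\<chi> (x D x\<^sup>-\<^sup>1)\<close>, where \<open>\<chi>\<close> is the character \<open>box_char \<mu> \<mu>'\<close>, over those \<open>x \<in> G\<close> for which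
  \<open>x D x\<^sup>-\<^sup>1\<close> lies in \<open>T\<close>, divided by \<open>card T\<close> (\<open>induced_trace_formula\<close>). Write
  \<open>\<epsilon> = \<alpha> - \<delta>\<close>, an element of valuation \<open>i\<close>.

  Every matrix with a unit in the upper left corner is, uniquely, a diagonal matrix in \<open>T\<close> times a
  matrix \<open>N = (1, b; c, 1 + b c)\<close> of determinant one (\<open>bij_betw_diag_shear\<close>), and the diagonal
  factor does not affect the summand. The conjugate \<open>N D N\<^sup>-\<^sup>1\<close> has diagonal entries
  \<open>\<alpha> + \<epsilon> b c\<close> and \<open>\<delta> - \<epsilon> b c\<close>, and it lies in \<open>T\<close> exactly if \<open>b\<close> and \<open>c\<close> are divisible by \<open>t ^ m\<close>,
  where \<open>m = max (l - i) 0\<close> (\<open>conj_term_shear\<close>). For such \<open>b\<close> the element \<open>\<epsilon> b c\<close> lies in the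
  ideal \<open>t ^ l R\<close> of square zero, so that
  \<open>\<mu> (\<alpha> + \<epsilon> b c) \<mu>' (\<delta> - \<epsilon> b c) / (\<mu> \<alpha> \<mu>' \<delta>)\<close> is an additive character of \<open>c \<in> t ^ m R\<close>
  (\<open>char_pair_additive\<close>). Regularity of the couple makes it nontrivial unless
  \<open>b\<close> is divisible by \<open>t ^ (r - i - m)\<close> (\<open>char_pair_nontrivial\<close>). Hence the sum over \<open>c\<close> vanishes
  for all other \<open>b\<close> (\<open>char_sum\<close>), and what remains is \<open>\<mu> \<alpha> \<mu>' \<delta>\<close> counted
  \<open>q ^ (i + m) * q ^ (r - m) = q ^ (r + i)\<close> times for each of the \<open>card (Units R) ^ 2\<close>
  diagonal factors (\<open>sum_conj_term_shear\<close>).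

  A matrix with a nonunit in the upper left corner becomes one of the first kind, with \<open>b\<close> a
  nonunit, after exchanging its columns, which exchanges \<open>\<alpha>\<close> and \<open>\<delta>\<close>. Since
  \<open>r - i - m \<ge> 1\<close>, the values of \<open>b\<close> that contribute are all nonunits, so this half of \<open>G\<close> yields
  \<open>\<mu> \<delta> \<mu>' \<alpha>\<close> with the same multiplicity. Dividing by
  \<open>card T = card (Units R) ^ 2 * q ^ r\<close> leaves the factor \<open>q ^ i\<close>.

  Of the ring \<open>\<O> / \<pi> ^ r\<close> this uses only that it is a finite chain ring: the ideals
  are the powers of \<open>(t)\<close>, the annihilator of \<open>t ^ j\<close> is \<open>(t ^ (r - j))\<close>, and \<open>t ^ (r - 1) R\<close> has \<open>q\<close>
  elements (\<open>trunc_ring_chain_ring\<close>).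
\<close>

section \<open>Traces on induced representations\<close>

text \<open>
  A family \<open>E x\<close> with \<open>f = (\<Sum>x. f x E x)\<close> on \<open>V\<close> is a reproducing kernel. It replaces the choice
  of an adapted basis: expanding each basis vector \<open>b\<close> in this way turns the
  trace into \<open>\<Sum>x \<Sum>b rep (A (E x)) b * b x\<close>, and the inner sum is the value of \<open>A (E x)\<close> at \<open>x\<close>,
  whichever basis was chosen.
\<close>

lemma trace_on_reproducing:
  fixes V :: "('g \<Rightarrow> complex) set"
  assumes V: "cfun.subspace V" and S: "finite S"
    and E: "\<And>x. x \<in> S \<Longrightarrow> E x \<in> V"
    and AE: "\<And>x. x \<in> S \<Longrightarrow> A (E x) \<in> V"
    and rep: "\<And>f. f \<in> V \<Longrightarrow> f = (\<Sum>x\<in>S. cfun_scale (f x) (E x))"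
    and lin: "\<And>f. f \<in> V \<Longrightarrow> A f = (\<Sum>x\<in>S. cfun_scale (f x) (A (E x)))"
  shows "cfun.trace_on V A = (\<Sum>x\<in>S. A (E x) x)"
proof -
  define B where "B = (SOME B. cfun.independent B \<and> cfun.span B = V)"
  obtain B0 where "B0 \<subseteq> V" "cfun.independent B0" "V \<subseteq> cfun.span B0"
    using cfun.maximal_independent_subset[of V] by metis
  hence "cfun.independent B0 \<and> cfun.span B0 = V"
    using cfun.span_minimal[OF _ V] by blast
  hence "cfun.independent B \<and> cfun.span B = V"
    unfolding B_def by (rule someI)
  hence B: "cfun.independent B" "cfun.span B = V" by auto
  have "f \<in> cfun.span (E ` S)" if "f \<in> V" for f
    by (subst rep[OF that]) (intro cfun.span_sum cfun.span_scale cfun.span_base imageI)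
  hence finB: "finite B"
    using cfun.independent_span_bound[of "E ` S" B] S B cfun.span_superset[of B] by blast
  have "cfun.trace_on V A = (\<Sum>b\<in>B. cfun.representation B (A b) b)"
    unfolding cfun.trace_on_def B_def[symmetric] Let_def ..
  also have "\<dots> = (\<Sum>b\<in>B. \<Sum>x\<in>S. b x * cfun.representation B (A (E x)) b)"
  proof (rule sum.cong[OF refl])
    fix b assume "b \<in> B"
    hence "b \<in> V" using B cfun.span_base by blast
    hence "cfun.representation B (A b) =
      (\<lambda>c. \<Sum>x\<in>S. cfun.representation B (cfun_scale (b x) (A (E x))) c)"
      using B AE cfun.subspace_scale[OF V]
      by (subst lin) (auto intro!: cfun.representation_sum)
    thus "cfun.representation B (A b) b = (\<Sum>x\<in>S. b x * cfun.representation B (A (E x)) b)"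
      using B AE by (auto simp: cfun.representation_scale intro!: sum.cong)
  qed
  also have "\<dots> = (\<Sum>x\<in>S. \<Sum>b\<in>B. cfun.representation B (A (E x)) b * b x)"
    by (subst sum.swap) (simp add: mult.commute)
  also have "\<dots> = (\<Sum>x\<in>S. A (E x) x)"
  proof (rule sum.cong[OF refl])
    fix x assume "x \<in> S"
    hence "(\<Sum>b\<in>B. cfun_scale (cfun.representation B (A (E x)) b) b) = A (E x)"
      using B AE finB by (intro cfun.sum_representation_eq) auto
    hence "(\<Sum>b\<in>B. cfun_scale (cfun.representation B (A (E x)) b) b) x = A (E x) x" by simp
    moreover have "(\<Sum>b\<in>C. f b) x = (\<Sum>b\<in>C. f b x)" for f :: "('g \<Rightarrow> complex) \<Rightarrow> 'g \<Rightarrow> complex" and C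
      by (induction C rule: infinite_finite_induct) auto
    ultimately show "(\<Sum>b\<in>B. cfun.representation B (A (E x)) b * b x) = A (E x) x"
      by (simp add: cfun_scale_def)
  qed
  finally show ?thesis .
qed

text \<open>
  The projection of the indicator function of \<open>{x}\<close> to the induced space, obtained by averaging over
  \<open>H\<close>, is supported on the coset \<open>H x\<close> with value \<open>\<chi> (y x\<^sup>-\<^sup>1) / card H\<close> at \<open>y\<close>. These
  projections are a reproducing kernel of the induced space.
\<close>

lemma induced_trace_formula:
  fixes G :: "('g, 'm) monoid_scheme" (structure)
  assumes G: "Group.group G" and fin: "finite (carrier G)" and H: "subgroup H G"
    and hom: "\<And>h k. h \<in> H \<Longrightarrow> k \<in> H \<Longrightarrow> \<chi> (h \<otimes> k) = \<chi> h * \<chi> k"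
    and g: "g \<in> carrier G"
  shows "of_nat (card H) * ind_trace G H \<chi> g =
    (\<Sum>x | x \<in> carrier G \<and> x \<otimes> g \<otimes> inv x \<in> H. \<chi> (x \<otimes> g \<otimes> inv x))"
proof -
  interpret Group.group G by fact
  interpret H: subgroup H G by fact
  note [simp] = H.mem_carrier
  have finH: "finite H" using fin H.subset finite_subset by blast
  have cH: "card H > 0" using finH H.one_closed card_gt_0_iff by blast
  define E where "E x = (\<lambda>y. if y \<in> carrier G \<and> y \<otimes> inv x \<in> H
    then \<chi> (y \<otimes> inv x) / of_nat (card H) else 0)" for x
  define V where "V = ind_space G H \<chi>"
  have sumapp: "(\<Sum>b\<in>C. f b) x = (\<Sum>b\<in>C. f b x)" for f :: "'g \<Rightarrow> 'g \<Rightarrow> complex" and C x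
    by (induction C rule: infinite_finite_induct) auto
  have V: "cfun.subspace V"
    unfolding V_def cfun.subspace_def ind_space_def by (auto simp: cfun_scale_def algebra_simps)
  have E: "E x \<in> V" if x: "x \<in> carrier G" for x
  proof -
    have "E x (h \<otimes> y) = \<chi> h * E x y" if "h \<in> H" "y \<in> carrier G" for h y
    proof -
      have eq: "h \<otimes> y \<otimes> inv x = h \<otimes> (y \<otimes> inv x)" using that x by (simp add: m_assoc)
      have "h \<otimes> (y \<otimes> inv x) \<in> H \<longleftrightarrow> y \<otimes> inv x \<in> H"
        using that x by (metis H.m_closed H.m_inv_closed H.mem_carrier inv_closed l_one l_inv m_assoc m_closed)
      thus ?thesis using that by (simp add: E_def eq hom)
    qed
    thus ?thesis unfolding V_def ind_space_def by (auto simp: E_def)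
  qed
  have act: "ind_action G g f \<in> V" if "f \<in> V" for f
    using that g unfolding V_def ind_space_def ind_action_def by (auto simp: m_assoc)
  have rep: "f y = (\<Sum>x\<in>carrier G. f x * E x y)" if f: "f \<in> V" and y: "y \<in> carrier G" for f y
  proof -
    have "(\<Sum>x\<in>carrier G. f x * E x y) = (\<Sum>x\<in>{x \<in> carrier G. y \<otimes> inv x \<in> H}. f x * E x y)"
      using fin by (intro sum.mono_neutral_right) (auto simp: E_def)
    also have "\<dots> = (\<Sum>x\<in>{x \<in> carrier G. y \<otimes> inv x \<in> H}. f y / of_nat (card H))"
    proof (rule sum.cong[OF refl])
      fix x assume x: "x \<in> {x \<in> carrier G. y \<otimes> inv x \<in> H}"
      have "f (y \<otimes> inv x \<otimes> x) = \<chi> (y \<otimes> inv x) * f x"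
        using f x unfolding V_def ind_space_def by auto
      moreover have "y \<otimes> inv x \<otimes> x = y" using x y by (simp add: m_assoc)
      ultimately show "f x * E x y = f y / of_nat (card H)" using x y by (simp add: E_def)
    qed
    also have "card {x \<in> carrier G. y \<otimes> inv x \<in> H} = card H"
    proof (rule bij_betw_same_card[symmetric], rule bij_betwI')
      fix h k assume "h \<in> H" "k \<in> H"
      thus "(inv h \<otimes> y = inv k \<otimes> y) = (h = k)" using y by (simp add: inv_eq_1_iff) (metis H.mem_carrier inv_inv)
    next
      fix h assume "h \<in> H"
      thus "inv h \<otimes> y \<in> {x \<in> carrier G. y \<otimes> inv x \<in> H}"
        using y by (simp add: inv_mult_group m_assoc[symmetric])
    next
      fix x assume "x \<in> {x \<in> carrier G. y \<otimes> inv x \<in> H}"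
      thus "\<exists>h\<in>H. x = inv h \<otimes> y" using y
        by (intro bexI[of _ "y \<otimes> inv x"]) (auto simp: inv_mult_group m_assoc)
    qed
    hence "(\<Sum>x\<in>{x \<in> carrier G. y \<otimes> inv x \<in> H}. f y / of_nat (card H)) = f y"
      using cH by simp
    finally show ?thesis by simp
  qed
  have V0: "f y = 0" if "f \<in> V" "y \<notin> carrier G" for f y
    using that unfolding V_def ind_space_def by auto
  have "cfun.trace_on V (ind_action G g) = (\<Sum>x\<in>carrier G. ind_action G g (E x) x)"
  proof (rule trace_on_reproducing[OF V fin])
    fix f assume f: "f \<in> V"
    show "f = (\<Sum>x\<in>carrier G. cfun_scale (f x) (E x))"
    proof
      fix y show "f y = (\<Sum>x\<in>carrier G. cfun_scale (f x) (E x)) y"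
        using rep[OF f, of y] V0[OF f, of y] by (cases "y \<in> carrier G") (auto simp: sumapp cfun_scale_def E_def)
    qed
    show "ind_action G g f = (\<Sum>x\<in>carrier G. cfun_scale (f x) (ind_action G g (E x)))"
    proof
      fix y show "ind_action G g f y = (\<Sum>x\<in>carrier G. cfun_scale (f x) (ind_action G g (E x))) y"
        using rep[OF f, of "y \<otimes> g"] g by (auto simp: sumapp cfun_scale_def ind_action_def)
    qed
  qed (use E act in auto)
  also have "\<dots> = (\<Sum>x\<in>carrier G. if x \<otimes> g \<otimes> inv x \<in> H then \<chi> (x \<otimes> g \<otimes> inv x) / of_nat (card H) else 0)"
    using g by (intro sum.cong) (auto simp: ind_action_def E_def)
  also have "\<dots> = (\<Sum>x | x \<in> carrier G \<and> x \<otimes> g \<otimes> inv x \<in> H. \<chi> (x \<otimes> g \<otimes> inv x) / of_nat (card H))"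
    using fin by (subst sum.inter_filter[symmetric]) auto
  finally show ?thesis
    using cH unfolding ind_trace_def V_def[symmetric] sum_divide_distrib[symmetric] by simp
qed

section \<open>Finite chain rings\<close>

lemma card_const_fibres:
  assumes "finite (f ` A)" and fib: "\<And>a. a \<in> A \<Longrightarrow> finite {x \<in> A. f x = f a} \<and> card {x \<in> A. f x = f a} = c"
  shows "finite A" and "card A = c * card (f ` A)"
proof -
  have A: "A = (\<Union>y\<in>f ` A. {x \<in> A. f x = y})" by auto
  show "finite A" by (subst A, rule finite_UN_I[OF assms(1)]) (use fib in auto)
  have "card A = (\<Sum>y\<in>f ` A. card {x \<in> A. f x = y})"
    by (subst A, rule card_UN_disjoint) (use assms in auto)
  also have "\<dots> = (\<Sum>y\<in>f ` A. c)" using fib by (intro sum.cong) auto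
  finally show "card A = c * card (f ` A)" by simp
qed

text \<open>
  A finite local principal ideal ring of length \<open>r\<close> with maximal ideal \<open>(t)\<close> and residue field of
  cardinality \<open>q\<close>. The cardinality is imposed on the minimal ideal \<open>(t ^ (r - 1))\<close>, which is a
  one-dimensional space over the residue field.
\<close>

locale chain_ring = cring R for R (structure) +
  fixes t :: 'a and r q :: nat
  assumes t_closed [simp]: "t \<in> carrier R"
    and t_nonunit: "t \<notin> Units R"
    and t_dvd_nonunit: "x \<in> carrier R \<Longrightarrow> x \<notin> Units R \<Longrightarrow> \<exists>y\<in>carrier R. x = t \<otimes> y"
    and t_pow_r: "t [^] r = \<zero>"
    and r_pos: "0 < r"
    and annihilator:
      "x \<in> carrier R \<Longrightarrow> j \<le> r \<Longrightarrow> t [^] j \<otimes> x = \<zero> \<Longrightarrow> \<exists>y\<in>carrier R. x = t [^] (r - j) \<otimes> y"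
    and socle_finite: "finite ((\<lambda>y. t [^] (r - 1) \<otimes> y) ` carrier R)"
    and socle_card: "card ((\<lambda>y. t [^] (r - 1) \<otimes> y) ` carrier R) = q"
begin

definition pow_ideal :: "nat \<Rightarrow> 'a set" where
  "pow_ideal k = (\<lambda>y. t [^] k \<otimes> y) ` carrier R"

lemma pow_idealI: "y \<in> carrier R \<Longrightarrow> t [^] k \<otimes> y \<in> pow_ideal k"
  by (auto simp: pow_ideal_def)

lemma pow_idealE:
  assumes "x \<in> pow_ideal k" obtains y where "y \<in> carrier R" "x = t [^] k \<otimes> y"
  using assms by (auto simp: pow_ideal_def)

lemma pow_ideal_closed: "x \<in> pow_ideal k \<Longrightarrow> x \<in> carrier R"
  by (auto simp: pow_ideal_def)

lemma pow_ideal_0 [simp]: "pow_ideal 0 = carrier R"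
  by (auto simp: pow_ideal_def image_iff)

lemma zero_in_pow_ideal [simp]: "\<zero> \<in> pow_ideal k"
  using pow_idealI[of \<zero> k] by simp

lemma pow_ideal_add: "x \<in> pow_ideal k \<Longrightarrow> y \<in> pow_ideal k \<Longrightarrow> x \<oplus> y \<in> pow_ideal k"
  by (elim pow_idealE) (metis r_distr nat_pow_closed t_closed add.m_closed pow_idealI)

lemma pow_ideal_minus: "x \<in> pow_ideal k \<Longrightarrow> \<ominus> x \<in> pow_ideal k"
  by (elim pow_idealE) (metis r_minus nat_pow_closed t_closed a_inv_closed pow_idealI)

lemma pow_ideal_mult: "x \<in> pow_ideal j \<Longrightarrow> y \<in> pow_ideal k \<Longrightarrow> x \<otimes> y \<in> pow_ideal (j + k)"
proof (elim pow_idealE)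
  fix a b assume ab: "a \<in> carrier R" "b \<in> carrier R" "x = t [^] j \<otimes> a" "y = t [^] k \<otimes> b"
  moreover have "t [^] j \<in> carrier R" "t [^] k \<in> carrier R" by auto
  ultimately have "x \<otimes> y = (t [^] j \<otimes> t [^] k) \<otimes> (a \<otimes> b)" by algebra
  thus "x \<otimes> y \<in> pow_ideal (j + k)" using ab pow_idealI[of "a \<otimes> b" "j + k"] by (simp add: nat_pow_mult)
qed

lemma pow_ideal_mult_left: "x \<in> carrier R \<Longrightarrow> y \<in> pow_ideal k \<Longrightarrow> x \<otimes> y \<in> pow_ideal k"
  using pow_ideal_mult[of x 0 y k] by simp

lemma pow_ideal_mult_right: "x \<in> pow_ideal k \<Longrightarrow> y \<in> carrier R \<Longrightarrow> x \<otimes> y \<in> pow_ideal k"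
  using pow_ideal_mult[of x k y 0] by simp

lemma pow_ideal_antimono: "j \<le> k \<Longrightarrow> x \<in> pow_ideal k \<Longrightarrow> x \<in> pow_ideal j"
  using pow_ideal_mult_left[of "t [^] (k - j)"]
  by (elim pow_idealE) (metis add_diff_inverse_nat leD m_assoc nat_pow_closed nat_pow_mult pow_idealI
      pow_ideal_mult_right t_closed)

lemma pow_ideal_trivial: "x \<in> pow_ideal k \<Longrightarrow> r \<le> k \<Longrightarrow> x = \<zero>"
  using pow_ideal_antimono[of r k x] t_pow_r by (auto simp: pow_ideal_def)

lemma nonunit_iff: "x \<in> carrier R \<Longrightarrow> x \<notin> Units R \<longleftrightarrow> x \<in> pow_ideal 1"
  using t_dvd_nonunit[of x] t_nonunit unit_factor[of t]
  by (auto simp: pow_ideal_def image_iff)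

lemma unit_add_nonunit:
  assumes "u \<in> Units R" "x \<in> pow_ideal 1" shows "u \<oplus> x \<in> Units R"
proof (rule ccontr)
  have c: "u \<in> carrier R" "x \<in> carrier R" using assms pow_ideal_closed by auto
  assume "u \<oplus> x \<notin> Units R"
  hence "(u \<oplus> x) \<oplus> \<ominus> x \<in> pow_ideal 1" using c assms nonunit_iff pow_ideal_add pow_ideal_minus by auto
  moreover have "(u \<oplus> x) \<oplus> \<ominus> x = u" using c by algebra
  ultimately show False using assms nonunit_iff c by auto
qed

text \<open>
  Truncated subtraction makes the statement true for \<open>j > k\<close> as well, where both sides hold.
\<close>

lemma pow_mult_in_pow_ideal_iff:
  assumes x: "x \<in> carrier R" and k: "k \<le> r"
  shows "t [^] j \<otimes> x \<in> pow_ideal k \<longleftrightarrow> x \<in> pow_ideal (k - j)"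
proof (cases "j \<le> k")
  case False
  thus ?thesis using x pow_ideal_antimono[of k j "t [^] j \<otimes> x"] pow_idealI by auto
next
  case j: True
  have tj: "t [^] i \<in> carrier R" for i :: nat by simp
  show ?thesis
  proof
    assume "t [^] j \<otimes> x \<in> pow_ideal k"
    then obtain y where y: "y \<in> carrier R" "t [^] j \<otimes> x = t [^] k \<otimes> y" by (rule pow_idealE)
    have z: "t [^] (k - j) \<otimes> y \<in> pow_ideal (k - j)" by (rule pow_idealI[OF y(1)])
    have "t [^] k = t [^] j \<otimes> t [^] (k - j)" using j by (simp add: nat_pow_mult)
    hence "t [^] j \<otimes> (x \<ominus> t [^] (k - j) \<otimes> y) = t [^] j \<otimes> x \<ominus> t [^] k \<otimes> y"
      using x y(1) tj[of j] tj[of "k - j"] by algebra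
    also have "\<dots> = \<zero>" using x y tj by (simp add: r_right_minus_eq)
    finally have "x \<ominus> t [^] (k - j) \<otimes> y \<in> pow_ideal (r - j)"
      using annihilator[of "x \<ominus> t [^] (k - j) \<otimes> y" j] x y j k pow_idealI by auto
    hence "x \<ominus> t [^] (k - j) \<otimes> y \<in> pow_ideal (k - j)" using k by (elim pow_ideal_antimono[rotated]) auto
    from pow_ideal_add[OF this z] show "x \<in> pow_ideal (k - j)"
      using x y(1) tj[of "k - j"] by (simp add: minus_eq a_assoc l_neg)
  next
    assume "x \<in> pow_ideal (k - j)"
    with pow_ideal_mult[of "t [^] j" j x "k - j"] pow_idealI[of \<one> j]
    show "t [^] j \<otimes> x \<in> pow_ideal k" using j by simp
  qed
qed

lemma unit_mult_in_pow_ideal_iff: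
  assumes "u \<in> Units R" "x \<in> carrier R"
  shows "u \<otimes> x \<in> pow_ideal k \<longleftrightarrow> x \<in> pow_ideal k"
proof
  assume "u \<otimes> x \<in> pow_ideal k"
  hence "inv u \<otimes> (u \<otimes> x) \<in> pow_ideal k" using assms by (auto intro: pow_ideal_mult_left[of "inv u"])
  moreover have "inv u \<otimes> (u \<otimes> x) = inv u \<otimes> u \<otimes> x" using assms by (intro m_assoc[symmetric]) auto
  ultimately show "x \<in> pow_ideal k" using assms by simp
qed (use assms pow_ideal_mult_left in auto)

lemma factor_outside_pow_ideal:
  assumes "b \<in> carrier R" "b \<notin> pow_ideal n"
  obtains j u where "j < n" "u \<in> Units R" "b = t [^] j \<otimes> u"
proof -
  define n' where "n' = (LEAST n. b \<notin> pow_ideal n)"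
  have n': "b \<notin> pow_ideal n'" "n' \<le> n" unfolding n'_def
    using LeastI[of "\<lambda>n. b \<notin> pow_ideal n", OF assms(2)] Least_le[of "\<lambda>n. b \<notin> pow_ideal n", OF assms(2)] by auto
  then obtain j where j: "n' = Suc j" using assms by (cases n') auto
  have "b \<in> pow_ideal j" using not_less_Least[of j "\<lambda>n. b \<notin> pow_ideal n"] j n'_def by auto
  then obtain u where u: "u \<in> carrier R" "b = t [^] j \<otimes> u" by (rule pow_idealE)
  have "u \<in> Units R"
  proof (rule ccontr)
    assume "u \<notin> Units R"
    hence "u \<in> pow_ideal 1" using u nonunit_iff by auto
    from pow_ideal_mult[OF pow_idealI[of \<one> j] this] show False using u n' j by simp
  qed
  thus thesis using that[of j u] u j n' by auto
qed

text \<open>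
  Multiplication by \<open>t\<close> maps \<open>(t ^ k)\<close> onto \<open>(t ^ (k + 1))\<close>, and its fibres are translates of the
  minimal ideal \<open>(t ^ (r - 1))\<close>, so that each step of the filtration contributes a factor \<open>q\<close>.
\<close>

lemma card_pow_ideal: "k \<le> r \<Longrightarrow> finite (pow_ideal k) \<and> card (pow_ideal k) = q ^ (r - k)"
proof (induction k rule: inc_induct)
  case base
  have "pow_ideal r = {\<zero>}" using pow_ideal_trivial by force
  thus ?case by simp
next
  case (step k)
  have im: "(\<lambda>x. t \<otimes> x) ` pow_ideal k = pow_ideal (Suc k)"
    unfolding pow_ideal_def image_image
    by (rule image_cong) (auto simp: m_assoc m_lcomm)
  have fib: "finite {x \<in> pow_ideal k. t \<otimes> x = t \<otimes> a} \<and> card {x \<in> pow_ideal k. t \<otimes> x = t \<otimes> a} = q"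
    if a: "a \<in> pow_ideal k" for a
  proof -
    have ac: "a \<in> carrier R" using a pow_ideal_closed by blast
    have "{x \<in> pow_ideal k. t \<otimes> x = t \<otimes> a} = (\<lambda>y. a \<oplus> y) ` pow_ideal (r - 1)"
    proof (rule Set.set_eqI, rule iffI)
      fix x assume "x \<in> {x \<in> pow_ideal k. t \<otimes> x = t \<otimes> a}"
      hence x: "x \<in> carrier R" "t \<otimes> x = t \<otimes> a" using pow_ideal_closed by auto
      have "t \<otimes> (x \<ominus> a) = t \<otimes> x \<ominus> t \<otimes> a" using x(1) ac t_closed by algebra
      hence "t [^] (1::nat) \<otimes> (x \<ominus> a) = \<zero>" using x ac by (simp add: r_right_minus_eq)
      hence "x \<ominus> a \<in> pow_ideal (r - 1)"
        using annihilator[of "x \<ominus> a" 1] x ac r_pos by (auto simp: pow_ideal_def)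
      moreover have "x = a \<oplus> (x \<ominus> a)" using x ac by algebra
      ultimately show "x \<in> (\<lambda>y. a \<oplus> y) ` pow_ideal (r - 1)" by blast
    next
      fix x assume "x \<in> (\<lambda>y. a \<oplus> y) ` pow_ideal (r - 1)"
      then obtain y where y: "y \<in> pow_ideal (r - 1)" "x = a \<oplus> y" by auto
      have "t \<otimes> y = \<zero>"
        using pow_ideal_trivial[OF pow_ideal_mult[OF pow_idealI[of \<one> 1] y(1)]] r_pos by simp
      moreover have "y \<in> pow_ideal k" using y step by (elim pow_ideal_antimono[rotated]) auto
      ultimately show "x \<in> {x \<in> pow_ideal k. t \<otimes> x = t \<otimes> a}"
        using y a ac pow_ideal_add pow_ideal_closed by (auto simp: r_distr)
    qed
    moreover have "inj_on (\<lambda>y. a \<oplus> y) (pow_ideal (r - 1))"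
      using ac pow_ideal_closed by (intro inj_onI) auto
    ultimately show ?thesis using socle_finite socle_card by (simp add: card_image pow_ideal_def)
  qed
  have "finite (pow_ideal k)" "card (pow_ideal k) = q * card (pow_ideal (Suc k))"
    using card_const_fibres[of "\<lambda>x. t \<otimes> x" "pow_ideal k" q] step fib unfolding im by auto
  thus ?case using step by (simp add: Suc_diff_Suc flip: power_Suc)
qed

lemma finite_carrier: "finite (carrier R)"
  using card_pow_ideal[of 0] by auto

lemma q_pos: "0 < q" using socle_finite socle_card by (metis card_gt_0_iff empty_iff image_is_empty one_closed)

end

section \<open>Truncations of the ring of integers of a local field\<close>

lemma bij_betw_images_same_kernel:
  assumes "\<And>x y. x \<in> A \<Longrightarrow> y \<in> A \<Longrightarrow> f x = f y \<longleftrightarrow> g x = g y"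
  shows "\<exists>h. bij_betw h (f ` A) (g ` A)"
proof
  have eq: "g (inv_into A f (f x)) = g x" if "x \<in> A" for x
    using assms[of "inv_into A f (f x)" x] that inv_into_into[of "f x" f A] f_inv_into_f[of "f x" f A] by auto
  thus "bij_betw (\<lambda>c. g (inv_into A f c)) (f ` A) (g ` A)"
    using assms unfolding bij_betw_def inj_on_def image_image
    by (simp add: eq cong: image_cong_simp)
qed

context nonarch_local_field
begin

lemma v_one: "v \<one> = 0"
  using v_mult[of \<one> \<one>] by simp

lemma v_neg: "x \<in> carrier F - {\<zero>} \<Longrightarrow> v (\<ominus> x) = v x"
proof -
  assume x: "x \<in> carrier F - {\<zero>}"
  have m: "\<ominus> \<one> \<in> carrier F - {\<zero>}" using zero_not_one by (metis DiffI a_inv_closed empty_iff insert_iff minus_minus minus_zero one_closed)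
  have "v (\<ominus> \<one>) + v (\<ominus> \<one>) = v (\<ominus> \<one> \<otimes> \<ominus> \<one>)" using v_mult[OF m m] ..
  also have "\<ominus> \<one> \<otimes> \<ominus> \<one> = \<one>" by algebra
  finally have "v (\<ominus> \<one>) = 0" using v_one by simp
  moreover have "\<ominus> x = \<ominus> \<one> \<otimes> x" using x by (simp add: l_minus)
  ultimately show ?thesis using v_mult[OF m x] by simp
qed

lemma v_inv: "x \<in> carrier F - {\<zero>} \<Longrightarrow> v (inv x) = - v x"
proof -
  assume x: "x \<in> carrier F - {\<zero>}"
  hence u: "x \<in> Units F" by (simp add: field_Units)
  have "inv x \<in> carrier F - {\<zero>}" using Units_inv_Units[OF u] by (simp add: field_Units)
  from v_mult[OF x this] show ?thesis using u v_one by simp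
qed

lemma frac_ideal_closed: "x \<in> frac_ideal F v n \<Longrightarrow> x \<in> carrier F"
  by (simp add: frac_ideal_def)

lemma frac_ideal_add:
  assumes "x \<in> frac_ideal F v n" "y \<in> frac_ideal F v n" shows "x \<oplus> y \<in> frac_ideal F v n"
  using assms v_add[of x y] by (cases "x = \<zero>"; cases "y = \<zero>"; cases "x \<oplus> y = \<zero>") (auto simp: frac_ideal_def)

lemma frac_ideal_neg: "x \<in> frac_ideal F v n \<Longrightarrow> \<ominus> x \<in> frac_ideal F v n"
  using v_neg[of x] by (auto simp: frac_ideal_def)

lemma frac_ideal_mult:
  assumes "x \<in> frac_ideal F v m" "y \<in> frac_ideal F v n" shows "x \<otimes> y \<in> frac_ideal F v (m + n)"
  using assms v_mult[of x y] by (cases "x = \<zero>"; cases "y = \<zero>") (auto simp: frac_ideal_def)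

lemma int_ring_simps [simp]:
  "carrier (int_ring F v) = frac_ideal F v 0"
  "x \<otimes>\<^bsub>int_ring F v\<^esub> y = x \<otimes> y" "\<one>\<^bsub>int_ring F v\<^esub> = \<one>"
  "x \<oplus>\<^bsub>int_ring F v\<^esub> y = x \<oplus> y" "\<zero>\<^bsub>int_ring F v\<^esub> = \<zero>"
  "x [^]\<^bsub>int_ring F v\<^esub> (n::nat) = x [^] n"
  by (auto simp: int_ring_def nat_pow_def)

lemma int_ring_cring: "cring (int_ring F v)"
proof -
  have "subring (frac_ideal F v 0) F"
  proof (rule subringI)
    show "\<one> \<in> frac_ideal F v 0" using v_one by (simp add: frac_ideal_def)
  qed (use frac_ideal_closed frac_ideal_neg frac_ideal_add frac_ideal_mult[of _ 0 _ 0] in auto)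
  thus ?thesis
    unfolding int_ring_def using subcring_iff[of "frac_ideal F v 0"] subcringI' frac_ideal_closed by blast
qed

lemma int_ring_minus:
  assumes "x \<in> frac_ideal F v 0" "y \<in> frac_ideal F v 0"
  shows "x \<ominus>\<^bsub>int_ring F v\<^esub> y = x \<ominus> y"
proof -
  interpret O: cring "int_ring F v" by (rule int_ring_cring)
  have "\<ominus>\<^bsub>int_ring F v\<^esub> y = \<ominus> y"
    using O.minus_equality[of "\<ominus> y" y] assms frac_ideal_neg[of y 0] frac_ideal_closed by (auto simp: l_neg)
  thus ?thesis by (simp add: a_minus_def)
qed

context
  fixes \<pi>
  assumes \<pi>: "uniformizer F v \<pi>"
begin

lemma pi_nonzero: "\<pi> \<in> carrier F - {\<zero>}" and v_pi: "v \<pi> = 1"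
  using \<pi> by (auto simp: uniformizer_def)

lemma pi_pow: "\<pi> [^] (k::nat) \<in> carrier F - {\<zero>} \<and> v (\<pi> [^] k) = int k"
  using pi_nonzero v_pi
  by (induction k) (auto simp: v_one integral_iff v_mult)

lemma frac_ideal_eq_pi_mult:
  assumes x: "x \<in> frac_ideal F v (int k + n)"
  shows "\<exists>y\<in>frac_ideal F v n. x = \<pi> [^] k \<otimes> y"
proof (intro bexI)
  have p: "\<pi> [^] k \<in> carrier F - {\<zero>}" and u: "\<pi> [^] k \<in> Units F" using pi_pow by (auto simp: field_Units)
  have i: "inv (\<pi> [^] k) \<in> frac_ideal F v (- int k)"
    using v_inv[OF p] pi_pow u by (simp add: frac_ideal_def)
  show "inv (\<pi> [^] k) \<otimes> x \<in> frac_ideal F v n" using frac_ideal_mult[OF i x] by simp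
  have "\<pi> [^] k \<otimes> (inv (\<pi> [^] k) \<otimes> x) = \<pi> [^] k \<otimes> inv (\<pi> [^] k) \<otimes> x"
    using p u x frac_ideal_closed by (intro m_assoc[symmetric]) auto
  thus "x = \<pi> [^] k \<otimes> (inv (\<pi> [^] k) \<otimes> x)" using u x frac_ideal_closed by simp
qed

lemma pi_pow_mult_in_frac_ideal_iff:
  assumes "x \<in> carrier F"
  shows "\<pi> [^] k \<otimes> x \<in> frac_ideal F v (int k + n) \<longleftrightarrow> x \<in> frac_ideal F v n"
proof (cases "x = \<zero>")
  case False
  hence "v (\<pi> [^] k \<otimes> x) = int k + v x" "\<pi> [^] k \<otimes> x \<noteq> \<zero>"
    using assms pi_pow[of k] by (auto simp: v_mult integral_iff)
  thus ?thesis using assms pi_pow[of k] False by (auto simp: frac_ideal_def)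
qed (use pi_pow[of k] in \<open>auto simp: frac_ideal_def\<close>)

lemma frac_ideal_eq_pi_ideal: "frac_ideal F v (int k) = pi_ideal F v \<pi> k"
proof -
  have "x \<otimes> \<pi> [^] k \<in> frac_ideal F v (int k)" if "x \<in> frac_ideal F v 0" for x
    using pi_pow_mult_in_frac_ideal_iff[of x k 0] that frac_ideal_closed pi_pow[of k] m_comm by auto
  moreover have "\<exists>y. x = y \<otimes> \<pi> [^] k \<and> y \<in> frac_ideal F v 0" if "x \<in> frac_ideal F v (int k)" for x
    using frac_ideal_eq_pi_mult[of x k 0] that frac_ideal_closed pi_pow[of k] m_comm by (metis DiffD1 add.right_neutral)
  ultimately show ?thesis unfolding pi_ideal_def cgenideal_def by auto
qed

lemma ideal_frac_ideal: "ideal (frac_ideal F v (int k)) (int_ring F v)"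
proof -
  interpret O: cring "int_ring F v" by (rule int_ring_cring)
  show ?thesis unfolding frac_ideal_eq_pi_ideal pi_ideal_def
    using pi_pow[of k] by (intro O.cgenideal_ideal) (simp add: frac_ideal_def)
qed

text \<open>
  The chain ring properties are read off from valuations of representatives. For the residue
  field, \<open>x \<mapsto> \<pi> ^ (r - 1) x\<close> identifies the residue classes modulo \<open>(\<pi>)\<close> with the elements of
  \<open>(t ^ (r - 1))\<close>, because both images of the ring of integers have the kernel \<open>(\<pi>)\<close>.
\<close>

lemma trunc_ring_chain_ring:
  assumes r: "0 < r"
  shows "chain_ring (trunc_ring F v \<pi> r) (trunc_pi F v \<pi> r) r (card (carrier (residue_field F v)))"
proof -
  interpret O: cring "int_ring F v" by (rule int_ring_cring)
  define R where "R = trunc_ring F v \<pi> r"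
  define t where "t = trunc_pi F v \<pi> r"
  define I where "I = frac_ideal F v (int r)"
  define h where "h = (+>\<^bsub>int_ring F v\<^esub>) I"
  have R_def': "R = int_ring F v Quot I"
    unfolding R_def I_def trunc_ring_def frac_ideal_eq_pi_ideal ..
  interpret I: ideal I "int_ring F v" unfolding I_def by (rule ideal_frac_ideal)
  interpret h: ring_hom_cring "int_ring F v" R h
    unfolding R_def' h_def by (rule I.rcos_ring_hom_cring[OF int_ring_cring])
  have surj: "carrier R = h ` frac_ideal F v 0"
    unfolding R_def' h_def FactRing_def A_RCOSETS_def' by auto
  have eq_iff: "h x = h y \<longleftrightarrow> x \<ominus> y \<in> I" if "x \<in> frac_ideal F v 0" "y \<in> frac_ideal F v 0" for x y
    unfolding h_def using that O.quotient_eq_iff_same_a_r_cos[OF I.ideal_axioms, of x y] int_ring_minus[of x y] by simp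
  have zero_iff: "h x = \<zero>\<^bsub>R\<^esub> \<longleftrightarrow> x \<in> I" if "x \<in> frac_ideal F v 0" for x
    using eq_iff[of x \<zero>] that h.hom_zero frac_ideal_closed[OF that] by (simp add: frac_ideal_def minus_eq)
  have piO: "\<pi> [^] (k::nat) \<in> frac_ideal F v 0" for k using pi_pow[of k] by (simp add: frac_ideal_def)
  have piO': "\<pi> \<in> frac_ideal F v 0" using piO[of 1] pi_nonzero by simp
  have t: "t = h \<pi>" unfolding t_def h_def I_def trunc_pi_def frac_ideal_eq_pi_ideal ..
  have tpow: "t [^]\<^bsub>R\<^esub> (k::nat) = h (\<pi> [^] k)" for k
    unfolding t using h.hom_pow[of \<pi> k] piO' by simp
  have tmult: "t [^]\<^bsub>R\<^esub> (k::nat) \<otimes>\<^bsub>R\<^esub> h x = h (\<pi> [^] k \<otimes> x)" if "x \<in> frac_ideal F v 0" for k x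
    unfolding tpow using h.hom_mult[of "\<pi> [^] k" x] piO that by simp
  have res: "carrier (residue_field F v) = (+>\<^bsub>int_ring F v\<^esub>) (frac_ideal F v 1) ` frac_ideal F v 0"
    unfolding residue_field_def FactRing_def A_RCOSETS_def' by auto
  have m: "ideal (frac_ideal F v 1) (int_ring F v)" using ideal_frac_ideal[of 1] by simp
  have socle: "(\<lambda>y. t [^]\<^bsub>R\<^esub> (r - 1) \<otimes>\<^bsub>R\<^esub> y) ` carrier R = (\<lambda>x. h (\<pi> [^] (r - 1) \<otimes> x)) ` frac_ideal F v 0"
    unfolding surj image_image using tmult by (intro image_cong) auto
  have socle_iff: "h (\<pi> [^] (r - 1) \<otimes> x) = h (\<pi> [^] (r - 1) \<otimes> y) \<longleftrightarrow>
      frac_ideal F v 1 +>\<^bsub>int_ring F v\<^esub> x = frac_ideal F v 1 +>\<^bsub>int_ring F v\<^esub> y"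
    if xy: "x \<in> frac_ideal F v 0" "y \<in> frac_ideal F v 0" for x y
  proof -
    have c: "x \<in> carrier F" "y \<in> carrier F" "\<pi> [^] (r - 1) \<in> carrier F"
      using xy piO frac_ideal_closed by auto
    have "\<pi> [^] (r - 1) \<otimes> x \<ominus> \<pi> [^] (r - 1) \<otimes> y = \<pi> [^] (r - 1) \<otimes> (x \<ominus> y)"
      using c by algebra
    moreover have "int (r - 1) + 1 = int r" using r by simp
    ultimately show ?thesis
      using eq_iff[of "\<pi> [^] (r - 1) \<otimes> x" "\<pi> [^] (r - 1) \<otimes> y"] xy piO frac_ideal_mult[of _ 0 _ 0]
        pi_pow_mult_in_frac_ideal_iff[of "x \<ominus> y" "r - 1" 1] c
        O.quotient_eq_iff_same_a_r_cos[OF m, of x y] int_ring_minus[of x y] by (simp add: I_def)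
  qed
  have "\<exists>f. bij_betw f (carrier (residue_field F v))
      ((\<lambda>y. t [^]\<^bsub>R\<^esub> (r - 1) \<otimes>\<^bsub>R\<^esub> y) ` carrier R)"
    unfolding res socle by (rule bij_betw_images_same_kernel) (rule socle_iff[symmetric])
  then obtain f where bij: "bij_betw f (carrier (residue_field F v))
      ((\<lambda>y. t [^]\<^bsub>R\<^esub> (r - 1) \<otimes>\<^bsub>R\<^esub> y) ` carrier R)" ..
  have "chain_ring R t r (card (carrier (residue_field F v)))"
  proof
    show "t \<in> carrier R" unfolding t surj using piO' by blast
    show "t \<notin> Units R"
    proof
      assume "t \<in> Units R"
      then obtain y where y: "y \<in> frac_ideal F v 0" "t \<otimes>\<^bsub>R\<^esub> h y = \<one>\<^bsub>R\<^esub>"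
        unfolding Units_def surj by auto
      hence "h (\<pi> \<otimes> y) = h \<one>" using h.hom_mult[of \<pi> y] piO' h.hom_one unfolding t by simp
      hence d: "\<pi> \<otimes> y \<ominus> \<one> \<in> I"
        using eq_iff[of "\<pi> \<otimes> y" \<one>] y piO' frac_ideal_mult[of _ 0 _ 0] v_one by (simp add: frac_ideal_def)
      have "\<pi> \<otimes> y \<ominus> \<one> \<in> frac_ideal F v 1" using d r by (auto simp: I_def frac_ideal_def)
      moreover have "\<pi> \<in> frac_ideal F v 1" using \<pi> by (simp add: frac_ideal_def uniformizer_def)
      hence p: "\<pi> \<otimes> y \<in> frac_ideal F v 1" using frac_ideal_mult[of \<pi> 1 y 0] y by simp
      \<comment> \<open>An inverse of \<open>t\<close> would put \<open>1\<close> into the maximal ideal.\<close>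
      ultimately have "\<pi> \<otimes> y \<oplus> \<ominus> (\<pi> \<otimes> y \<ominus> \<one>) \<in> frac_ideal F v 1"
        by (intro frac_ideal_add frac_ideal_neg)
      moreover have "\<pi> \<otimes> y \<oplus> \<ominus> (\<pi> \<otimes> y \<ominus> \<one>) = \<one>"
        using frac_ideal_closed[OF p] one_closed by algebra
      ultimately show False using v_one by (simp add: frac_ideal_def)
    qed
    show "t [^]\<^bsub>R\<^esub> r = \<zero>\<^bsub>R\<^esub>" using zero_iff[OF piO, of r] pi_pow[of r] unfolding tpow I_def
      by (simp add: frac_ideal_def)
    show "0 < r" by fact
    show "finite ((\<lambda>y. t [^]\<^bsub>R\<^esub> (r - 1) \<otimes>\<^bsub>R\<^esub> y) ` carrier R)"
      "card ((\<lambda>y. t [^]\<^bsub>R\<^esub> (r - 1) \<otimes>\<^bsub>R\<^esub> y) ` carrier R) = card (carrier (residue_field F v))"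
      using bij finite_residue_field bij_betw_finite bij_betw_same_card by metis+
  next
    fix x assume "x \<in> carrier R" "x \<notin> Units R"
    then obtain a where a: "a \<in> frac_ideal F v 0" "x = h a" unfolding surj by auto
    have "a \<in> frac_ideal F v 1"
    proof (rule ccontr)
      assume "a \<notin> frac_ideal F v 1"
      hence v: "a \<in> carrier F - {\<zero>}" "v a = 0" using a by (auto simp: frac_ideal_def)
      hence u: "a \<in> Units F" by (simp add: field_Units)
      hence i: "inv a \<in> frac_ideal F v 0" using v_inv[OF v(1)] v by (simp add: frac_ideal_def)
      have "h a \<otimes>\<^bsub>R\<^esub> h (inv a) = \<one>\<^bsub>R\<^esub>" "h (inv a) \<otimes>\<^bsub>R\<^esub> h a = \<one>\<^bsub>R\<^esub>"
        using h.hom_mult[of a "inv a"] h.hom_mult[of "inv a" a] a i u h.hom_one by auto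
      hence "x \<in> Units R" using a i h.hom_closed by (auto simp: Units_def)
      thus False using \<open>x \<notin> Units R\<close> by blast
    qed
    then obtain b where "b \<in> frac_ideal F v 0" "a = \<pi> \<otimes> b"
      using frac_ideal_eq_pi_mult[of a 1 0] pi_nonzero by auto
    thus "\<exists>y\<in>carrier R. x = t \<otimes>\<^bsub>R\<^esub> y"
      using a h.hom_mult[of \<pi> b] piO' unfolding t by (auto intro!: bexI[of _ "h b"])
  next
    fix x j assume "x \<in> carrier R" and j: "j \<le> r" and z: "t [^]\<^bsub>R\<^esub> j \<otimes>\<^bsub>R\<^esub> x = \<zero>\<^bsub>R\<^esub>"
    then obtain a where a: "a \<in> frac_ideal F v 0" "x = h a" unfolding surj by auto
    have "\<pi> [^] j \<otimes> a \<in> I"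
      using z a tmult[of a j] zero_iff[of "\<pi> [^] j \<otimes> a"] piO frac_ideal_mult[of "\<pi> [^] j" 0 a 0] by simp
    hence "a \<in> frac_ideal F v (int (r - j))"
      using pi_pow_mult_in_frac_ideal_iff[of a j "int (r - j)"] a j frac_ideal_closed by (simp add: I_def)
    then obtain b where "b \<in> frac_ideal F v 0" "a = \<pi> [^] (r - j) \<otimes> b"
      using frac_ideal_eq_pi_mult[of a "r - j" 0] by auto
    thus "\<exists>y\<in>carrier R. x = t [^]\<^bsub>R\<^esub> (r - j) \<otimes>\<^bsub>R\<^esub> y"
      using a tmult[of b] by (auto intro!: bexI[of _ "h b"])
  qed
  thus ?thesis unfolding R_def t_def .
qed

end
end

section \<open>The group GL(2) over a commutative ring\<close>

definition det2 :: "('a, 'b) ring_scheme \<Rightarrow> 'a mat2 \<Rightarrow> 'a" where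
  "det2 R x = e11 x \<otimes>\<^bsub>R\<^esub> e22 x \<ominus>\<^bsub>R\<^esub> e12 x \<otimes>\<^bsub>R\<^esub> e21 x"

lemma Mat2_in_M2 [simp]:
  "Mat2 a b c d \<in> carrier (M2 R) \<longleftrightarrow> a \<in> carrier R \<and> b \<in> carrier R \<and> c \<in> carrier R \<and> d \<in> carrier R"
  by (simp add: M2_def)

lemma Mat2_mult [simp]:
  "Mat2 a b c d \<otimes>\<^bsub>M2 R\<^esub> Mat2 a' b' c' d' =
    Mat2 (a \<otimes>\<^bsub>R\<^esub> a' \<oplus>\<^bsub>R\<^esub> b \<otimes>\<^bsub>R\<^esub> c') (a \<otimes>\<^bsub>R\<^esub> b' \<oplus>\<^bsub>R\<^esub> b \<otimes>\<^bsub>R\<^esub> d')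
      (c \<otimes>\<^bsub>R\<^esub> a' \<oplus>\<^bsub>R\<^esub> d \<otimes>\<^bsub>R\<^esub> c') (c \<otimes>\<^bsub>R\<^esub> b' \<oplus>\<^bsub>R\<^esub> d \<otimes>\<^bsub>R\<^esub> d')"
  by (simp add: M2_def)

lemma M2_one: "\<one>\<^bsub>M2 R\<^esub> = Mat2 \<one>\<^bsub>R\<^esub> \<zero>\<^bsub>R\<^esub> \<zero>\<^bsub>R\<^esub> \<one>\<^bsub>R\<^esub>"
  by (simp add: M2_def)

lemma M2_cases:
  assumes "x \<in> carrier (M2 R)"
  obtains a b c d where "x = Mat2 a b c d" "a \<in> carrier R" "b \<in> carrier R" "c \<in> carrier R" "d \<in> carrier R"
  using assms by (auto simp: M2_def)

context cring
begin

lemma M2_monoid: "Group.monoid (M2 R)"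
proof
  fix x y z assume "x \<in> carrier (M2 R)" "y \<in> carrier (M2 R)" "z \<in> carrier (M2 R)"
  then obtain a b c d a' b' c' d' a'' b'' c'' d'' where
    x: "x = Mat2 a b c d" "a \<in> carrier R" "b \<in> carrier R" "c \<in> carrier R" "d \<in> carrier R"
    and y: "y = Mat2 a' b' c' d'" "a' \<in> carrier R" "b' \<in> carrier R" "c' \<in> carrier R" "d' \<in> carrier R"
    and z: "z = Mat2 a'' b'' c'' d''" "a'' \<in> carrier R" "b'' \<in> carrier R" "c'' \<in> carrier R" "d'' \<in> carrier R"
    by (elim M2_cases)
  show "x \<otimes>\<^bsub>M2 R\<^esub> y \<otimes>\<^bsub>M2 R\<^esub> z = x \<otimes>\<^bsub>M2 R\<^esub> (y \<otimes>\<^bsub>M2 R\<^esub> z)"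
    unfolding x(1) y(1) z(1) Mat2_mult mat2.inject
    using x(2-) y(2-) z(2-) by (intro conjI; algebra)
qed (auto simp: M2_one elim!: M2_cases)

lemma det2_mult:
  assumes "x \<in> carrier (M2 R)" "y \<in> carrier (M2 R)"
  shows "det2 R (x \<otimes>\<^bsub>M2 R\<^esub> y) = det2 R x \<otimes> det2 R y"
proof -
  obtain a b c d a' b' c' d' where
    x: "x = Mat2 a b c d" "a \<in> carrier R" "b \<in> carrier R" "c \<in> carrier R" "d \<in> carrier R"
    and y: "y = Mat2 a' b' c' d'" "a' \<in> carrier R" "b' \<in> carrier R" "c' \<in> carrier R" "d' \<in> carrier R"
    using assms by (elim M2_cases)
  show ?thesis unfolding x(1) y(1) Mat2_mult det2_def mat2.sel
    using x(2-) y(2-) by algebra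
qed

lemma GL2_group: "Group.group (GL2 R)"
  unfolding GL2_def by (rule monoid.units_group[OF M2_monoid])

lemma GL2_mult [simp]: "x \<otimes>\<^bsub>GL2 R\<^esub> y = x \<otimes>\<^bsub>M2 R\<^esub> y"
  by (simp add: GL2_def units_of_mult)

lemma GL2_one: "\<one>\<^bsub>GL2 R\<^esub> = Mat2 \<one> \<zero> \<zero> \<one>"
  by (simp add: GL2_def units_of_one M2_one)

lemma GL2_carrier: "carrier (GL2 R) = {x \<in> carrier (M2 R). det2 R x \<in> Units R}"
proof -
  interpret M: Group.monoid "M2 R" by (rule M2_monoid)
  have dc: "det2 R x \<in> carrier R" if "x \<in> carrier (M2 R)" for x
    using that by (auto simp: det2_def elim!: M2_cases)
  have d1: "det2 R \<one>\<^bsub>M2 R\<^esub> = \<one>" unfolding M2_one det2_def mat2.sel by algebra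
  show ?thesis unfolding GL2_def units_of_carrier
  proof (intro equalityI subsetI CollectI conjI)
    fix x assume x: "x \<in> Units (M2 R)"
    thus "x \<in> carrier (M2 R)" by auto
    from x obtain y where "y \<in> carrier (M2 R)" "y \<otimes>\<^bsub>M2 R\<^esub> x = \<one>\<^bsub>M2 R\<^esub>" "x \<otimes>\<^bsub>M2 R\<^esub> y = \<one>\<^bsub>M2 R\<^esub>"
      by (auto simp: Units_def)
    thus "det2 R x \<in> Units R"
      using det2_mult[of x y] det2_mult[of y x] x dc d1 unfolding Units_def by auto
  next
    fix x assume x: "x \<in> {x \<in> carrier (M2 R). det2 R x \<in> Units R}"
    then obtain a b c d where
      abcd: "x = Mat2 a b c d" "a \<in> carrier R" "b \<in> carrier R" "c \<in> carrier R" "d \<in> carrier R"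
      by (auto elim: M2_cases)
    define e where "e = inv (det2 R x)"
    have e: "e \<in> carrier R" "e \<otimes> (a \<otimes> d \<ominus> b \<otimes> c) = \<one>"
      using x Units_l_inv[of "det2 R x"] unfolding e_def abcd(1) by (auto simp: det2_def)
    define y where "y = Mat2 (e \<otimes> d) (\<ominus> (e \<otimes> b)) (\<ominus> (e \<otimes> c)) (e \<otimes> a)"
    have "y \<in> carrier (M2 R)" using abcd e by (simp add: y_def)
    moreover have "x \<otimes>\<^bsub>M2 R\<^esub> y = Mat2 (e \<otimes> (a \<otimes> d \<ominus> b \<otimes> c)) \<zero> \<zero> (e \<otimes> (a \<otimes> d \<ominus> b \<otimes> c))"
      unfolding y_def abcd(1) Mat2_mult mat2.inject using abcd(2-) e(1) by (intro conjI; algebra)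
    moreover have "y \<otimes>\<^bsub>M2 R\<^esub> x = Mat2 (e \<otimes> (a \<otimes> d \<ominus> b \<otimes> c)) \<zero> \<zero> (e \<otimes> (a \<otimes> d \<ominus> b \<otimes> c))"
      unfolding y_def abcd(1) Mat2_mult mat2.inject using abcd(2-) e(1) by (intro conjI; algebra)
    ultimately show "x \<in> Units (M2 R)" using x e unfolding Units_def M2_one by auto
  qed
qed

lemma Mat2_in_GL2:
  "Mat2 a b c d \<in> carrier (GL2 R) \<longleftrightarrow> a \<in> carrier R \<and> b \<in> carrier R \<and> c \<in> carrier R \<and>
    d \<in> carrier R \<and> a \<otimes> d \<ominus> b \<otimes> c \<in> Units R"
  by (simp add: GL2_carrier det2_def)

end

text \<open>
  The summand of the induced character formula, extended by zero to all of \<open>G\<close>.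
\<close>

definition conj_term ::
  "('g, 'm) monoid_scheme \<Rightarrow> 'g set \<Rightarrow> ('g \<Rightarrow> complex) \<Rightarrow> 'g \<Rightarrow> 'g \<Rightarrow> complex" where
  "conj_term G H \<chi> g x =
    (if x \<otimes>\<^bsub>G\<^esub> g \<otimes>\<^bsub>G\<^esub> inv\<^bsub>G\<^esub> x \<in> H then \<chi> (x \<otimes>\<^bsub>G\<^esub> g \<otimes>\<^bsub>G\<^esub> inv\<^bsub>G\<^esub> x) else 0)"

context Group.group
begin

lemma conj_term_left_mult:
  assumes H: "subgroup H G" and hom: "\<And>h k. h \<in> H \<Longrightarrow> k \<in> H \<Longrightarrow> \<chi> (h \<otimes> k) = \<chi> h * \<chi> k"
    and one: "\<chi> \<one> = 1"
    and h: "h \<in> H" and x: "x \<in> carrier G" and g: "g \<in> carrier G"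
  shows "conj_term G H \<chi> g (h \<otimes> x) = conj_term G H \<chi> g x"
proof -
  interpret H: subgroup H G by fact
  have hc: "h \<in> carrier G" using h by simp
  define y where "y = x \<otimes> g \<otimes> inv x"
  have y: "y \<in> carrier G" using x g by (simp add: y_def)
  have eq: "h \<otimes> x \<otimes> g \<otimes> inv (h \<otimes> x) = h \<otimes> y \<otimes> inv h"
    using hc x g by (simp add: y_def inv_mult_group m_assoc)
  have "y = inv h \<otimes> (h \<otimes> y \<otimes> inv h) \<otimes> h" using hc y by (simp add: m_assoc inv_solve_left)
  hence "h \<otimes> y \<otimes> inv h \<in> H \<longleftrightarrow> y \<in> H" using h H.m_closed H.m_inv_closed by metis
  moreover have "\<chi> (h \<otimes> y \<otimes> inv h) = \<chi> y" if "y \<in> H"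
  proof -
    have "\<chi> h * \<chi> (inv h) = 1" using hom[of h "inv h"] h one by simp
    thus ?thesis using that h by (simp add: hom)
  qed
  ultimately show ?thesis unfolding conj_term_def eq by (simp add: y_def)
qed

text \<open>
  This lets the exchange of columns be traded for an exchange of the diagonal entries.
\<close>

lemma conj_term_right_mult:
  assumes "x \<in> carrier G" "g \<in> carrier G" "w \<in> carrier G"
  shows "conj_term G H \<chi> g (x \<otimes> w) = conj_term G H \<chi> (w \<otimes> g \<otimes> inv w) x"
  using assms by (simp add: conj_term_def inv_mult_group m_assoc)

end

lemma unit_char_mult:
  assumes "unit_char R \<mu>" "x \<in> Units R" "y \<in> Units R"
  shows "\<mu> (x \<otimes>\<^bsub>R\<^esub> y) = \<mu> x * \<mu> y"
  using assms by (auto simp: unit_char_def hom_def units_of_def C_star_def)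

lemma unit_char_nonzero: "unit_char R \<mu> \<Longrightarrow> x \<in> Units R \<Longrightarrow> \<mu> x \<noteq> 0"
  by (auto simp: unit_char_def hom_def units_of_def C_star_def)

lemma (in ring) unit_char_one: "unit_char R \<mu> \<Longrightarrow> \<mu> \<one> = 1"
  using unit_char_mult[of R \<mu> \<one> \<one>] unit_char_nonzero[of R \<mu> \<one>] by simp

section \<open>The principal split character over a chain ring\<close>

locale split_couple = chain_ring +
  fixes \<mu> \<mu>' :: "'a \<Rightarrow> complex" and l :: nat
  assumes r_eq: "r = 2 * l" and regular: "regular_couple R t r \<mu> \<mu>'"
begin

abbreviation "G \<equiv> GL2 R"
abbreviation "T \<equiv> T_subgroup R t l"
abbreviation "\<chi> \<equiv> box_char \<mu> \<mu>'"

sublocale G: Group.group G by (rule GL2_group)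

lemma l_pos: "0 < l" using r_pos r_eq by simp

lemma chars: "unit_char R \<mu>" "unit_char R \<mu>'"
  using regular by (auto simp: regular_couple_def)

lemmas char_mult = unit_char_mult[OF chars(1)] unit_char_mult[OF chars(2)]

lemma char_one: "\<mu> \<one> = 1" "\<mu>' \<one> = 1" using chars unit_char_one by auto

lemma Mat2_in_T_iff: "Mat2 a b c d \<in> T \<longleftrightarrow> a \<in> Units R \<and> d \<in> Units R \<and> b \<in> pow_ideal l \<and> c \<in> pow_ideal l"
  unfolding T_subgroup_def pow_ideal_def by auto

lemma T_cases:
  assumes "x \<in> T"
  obtains a b c d where "x = Mat2 a b c d" "a \<in> Units R" "d \<in> Units R" "b \<in> pow_ideal l" "c \<in> pow_ideal l"
  using assms Mat2_in_T_iff by (cases x) auto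

lemma pow_ideal_l_mult: "x \<in> pow_ideal l \<Longrightarrow> y \<in> pow_ideal l \<Longrightarrow> x \<otimes> y = \<zero>"
  using pow_ideal_mult[of x l y l] pow_ideal_trivial[of "x \<otimes> y" "l + l"] r_eq by simp

lemma T_subset: "T \<subseteq> carrier G"
  by (auto elim!: T_cases simp: Mat2_in_GL2 pow_ideal_closed pow_ideal_l_mult minus_eq Units_closed)

text \<open>
  Since \<open>2 l = r\<close>, the off-diagonal entries of two elements of \<open>T\<close> have product zero, and the diagonal
  entries multiply separately.
\<close>

lemma T_mult:
  assumes "x \<in> T" "y \<in> T"
  shows "x \<otimes>\<^bsub>G\<^esub> y \<in> T" and "\<chi> (x \<otimes>\<^bsub>G\<^esub> y) = \<chi> x * \<chi> y"
proof -
  obtain a b c d a' b' c' d' where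
    x: "x = Mat2 a b c d" "a \<in> Units R" "d \<in> Units R" "b \<in> pow_ideal l" "c \<in> pow_ideal l"
    and y: "y = Mat2 a' b' c' d'" "a' \<in> Units R" "d' \<in> Units R" "b' \<in> pow_ideal l" "c' \<in> pow_ideal l"
    using assms by (elim T_cases)
  have eq: "x \<otimes>\<^bsub>G\<^esub> y = Mat2 (a \<otimes> a') (a \<otimes> b' \<oplus> b \<otimes> d') (c \<otimes> a' \<oplus> d \<otimes> c') (d \<otimes> d')"
    using x y by (simp add: pow_ideal_l_mult Units_closed)
  show "x \<otimes>\<^bsub>G\<^esub> y \<in> T" unfolding eq Mat2_in_T_iff
    using x y by (auto intro!: pow_ideal_add intro: pow_ideal_mult_left pow_ideal_mult_right)
  show "\<chi> (x \<otimes>\<^bsub>G\<^esub> y) = \<chi> x * \<chi> y" unfolding eq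
    using x y by (simp add: box_char_def char_mult)
qed

lemma T_subgroup: "subgroup T G"
proof (rule G.subgroupI[OF T_subset])
  show "T \<noteq> {}" using Mat2_in_T_iff[of \<one> \<zero> \<zero> \<one>] by auto
  fix x assume xT: "x \<in> T"
  then obtain a b c d where x: "x = Mat2 a b c d" "a \<in> Units R" "d \<in> Units R" "b \<in> pow_ideal l" "c \<in> pow_ideal l"
    by (rule T_cases)
  define y where "y = Mat2 (inv a) (\<ominus> (inv a \<otimes> inv d \<otimes> b)) (\<ominus> (inv a \<otimes> inv d \<otimes> c)) (inv d)"
  have yT: "y \<in> T" unfolding y_def Mat2_in_T_iff
    using x by (auto intro!: pow_ideal_minus pow_ideal_mult_left)
  have c: "a \<in> carrier R" "inv a \<in> carrier R" "d \<in> carrier R" "inv d \<in> carrier R"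
      "b \<in> carrier R" "c \<in> carrier R" "inv a \<otimes> a = \<one>" "inv d \<otimes> d = \<one>" "c \<otimes> b = \<zero>" "b \<otimes> c = \<zero>"
    using x pow_ideal_closed pow_ideal_l_mult by auto
  have "inv a \<otimes> a \<oplus> \<ominus> (inv a \<otimes> inv d \<otimes> b) \<otimes> c = inv a \<otimes> a \<ominus> inv a \<otimes> inv d \<otimes> (b \<otimes> c)"
    using c(1-6) by algebra
  moreover have "inv a \<otimes> b \<oplus> \<ominus> (inv a \<otimes> inv d \<otimes> b) \<otimes> d = inv a \<otimes> b \<ominus> inv a \<otimes> b \<otimes> (inv d \<otimes> d)"
    using c(1-6) by algebra
  moreover have "\<ominus> (inv a \<otimes> inv d \<otimes> c) \<otimes> a \<oplus> inv d \<otimes> c = inv d \<otimes> c \<ominus> inv d \<otimes> c \<otimes> (inv a \<otimes> a)"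
    using c(1-6) by algebra
  moreover have "\<ominus> (inv a \<otimes> inv d \<otimes> c) \<otimes> b \<oplus> inv d \<otimes> d = inv d \<otimes> d \<ominus> inv a \<otimes> inv d \<otimes> (c \<otimes> b)"
    using c(1-6) by algebra
  ultimately have "y \<otimes>\<^bsub>G\<^esub> x = \<one>\<^bsub>G\<^esub>"
    unfolding y_def x(1) GL2_mult Mat2_mult GL2_one
    using c by (simp add: minus_eq r_neg)
  hence "inv\<^bsub>G\<^esub> x = y" using xT yT T_subset by (intro G.inv_equality) auto
  thus "inv\<^bsub>G\<^esub> x \<in> T" using yT by simp
qed (rule T_mult)

lemma card_T: "card T = card (Units R) ^ 2 * q ^ r"
proof -
  have "bij_betw (\<lambda>(a, d, b, c). Mat2 a b c d) (Units R \<times> Units R \<times> pow_ideal l \<times> pow_ideal l) T"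
    by (rule bij_betwI[where g = "\<lambda>x. (e11 x, e22 x, e12 x, e21 x)"])
      (auto simp: Mat2_in_T_iff elim!: T_cases)
  hence "card T = card (Units R \<times> Units R \<times> pow_ideal l \<times> pow_ideal l)"
    using bij_betw_same_card by metis
  thus ?thesis using card_pow_ideal[of l] r_eq
    by (simp add: card_cartesian_product power2_eq_square mult_2 power_add)
qed

lemma finite_GL2: "finite (carrier G)"
proof (rule finite_subset)
  show "carrier G \<subseteq> (\<lambda>(a, b, c, d). Mat2 a b c d) ` (carrier R \<times> carrier R \<times> carrier R \<times> carrier R)"
    by (force simp: GL2_carrier elim!: M2_cases)
qed (use finite_carrier in auto)

text \<open>
  The general matrix of determinant one with \<open>1\<close> in the upper left corner. The parameters \<open>b\<close> and
  \<open>c\<close> are unconstrained, which keeps the later sum over \<open>c\<close> a sum over a full ideal.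
\<close>

definition shear :: "'a \<Rightarrow> 'a \<Rightarrow> 'a mat2" where
  "shear b c = Mat2 \<one> b c (\<one> \<oplus> b \<otimes> c)"

lemma shear_in_GL2: "b \<in> carrier R \<Longrightarrow> c \<in> carrier R \<Longrightarrow> shear b c \<in> carrier G"
  unfolding shear_def Mat2_in_GL2 by (simp add: minus_eq a_assoc r_neg)

lemma diag_mult_shear:
  assumes "s\<^sub>1 \<in> carrier R" "s\<^sub>2 \<in> carrier R" "b \<in> carrier R" "c \<in> carrier R"
  shows "Mat2 s\<^sub>1 \<zero> \<zero> s\<^sub>2 \<otimes>\<^bsub>G\<^esub> shear b c = Mat2 s\<^sub>1 (s\<^sub>1 \<otimes> b) (s\<^sub>2 \<otimes> c) (s\<^sub>2 \<otimes> (\<one> \<oplus> b \<otimes> c))"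
  using assms by (simp add: shear_def)

text \<open>
  The diagonal factor of \<open>x\<close> must be \<open>s\<^sub>1 = e11 x\<close> and \<open>s\<^sub>2 = det x / s\<^sub>1\<close>, because the other factor
  has determinant one; this determines \<open>b\<close> and \<open>c\<close>.
  The set \<open>B\<close> of admissible \<open>b\<close> is left open, because the two halves of the group require all of \<open>R\<close>
  and the maximal ideal respectively.
\<close>

lemma bij_betw_diag_shear:
  assumes B: "B \<subseteq> carrier R"
  shows "bij_betw (\<lambda>(s\<^sub>1, s\<^sub>2, b, c). Mat2 s\<^sub>1 \<zero> \<zero> s\<^sub>2 \<otimes>\<^bsub>G\<^esub> shear b c)
    (Units R \<times> Units R \<times> B \<times> carrier R)
    {x \<in> carrier G. e11 x \<in> Units R \<and> inv (e11 x) \<otimes> e12 x \<in> B}"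
proof -
  define d where "d x = inv (e11 x) \<otimes> det2 R x" for x
  have inv_mult: "inv s \<otimes> (s \<otimes> b) = b" if "s \<in> Units R" "b \<in> carrier R" for s b
  proof -
    have "inv s \<otimes> (s \<otimes> b) = inv s \<otimes> s \<otimes> b" using that by (intro m_assoc[symmetric]) auto
    thus ?thesis using that by simp
  qed
  have mult_inv: "s \<otimes> (inv s \<otimes> b) = b" if "s \<in> Units R" "b \<in> carrier R" for s b
    using inv_mult[of "inv s" b] that by simp
  show ?thesis
  proof (rule bij_betwI[where g = "\<lambda>x. (e11 x, d x, inv (e11 x) \<otimes> e12 x, inv (d x) \<otimes> e21 x)"])
    show "(\<lambda>(s\<^sub>1, s\<^sub>2, b, c). Mat2 s\<^sub>1 \<zero> \<zero> s\<^sub>2 \<otimes>\<^bsub>G\<^esub> shear b c) \<in>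
      Units R \<times> Units R \<times> B \<times> carrier R \<rightarrow> {x \<in> carrier G. e11 x \<in> Units R \<and> inv (e11 x) \<otimes> e12 x \<in> B}"
    proof clarify
      fix s\<^sub>1 s\<^sub>2 b c assume *: "s\<^sub>1 \<in> Units R" "s\<^sub>2 \<in> Units R" "b \<in> B" "c \<in> carrier R"
      have T: "Mat2 s\<^sub>1 \<zero> \<zero> s\<^sub>2 \<in> carrier G" using * T_subset Mat2_in_T_iff by auto
      show "Mat2 s\<^sub>1 \<zero> \<zero> s\<^sub>2 \<otimes>\<^bsub>G\<^esub> shear b c \<in> carrier G \<and>
        e11 (Mat2 s\<^sub>1 \<zero> \<zero> s\<^sub>2 \<otimes>\<^bsub>G\<^esub> shear b c) \<in> Units R \<and>
        inv (e11 (Mat2 s\<^sub>1 \<zero> \<zero> s\<^sub>2 \<otimes>\<^bsub>G\<^esub> shear b c)) \<otimes> e12 (Mat2 s\<^sub>1 \<zero> \<zero> s\<^sub>2 \<otimes>\<^bsub>G\<^esub> shear b c) \<in> B"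
      proof
        show "Mat2 s\<^sub>1 \<zero> \<zero> s\<^sub>2 \<otimes>\<^bsub>G\<^esub> shear b c \<in> carrier G"
          by (rule G.m_closed[OF T shear_in_GL2]) (use * B in auto)
      qed (use * B in \<open>simp add: diag_mult_shear Units_closed inv_mult subsetD[OF B] del: GL2_mult\<close>)
    qed
  next
    show "(\<lambda>x. (e11 x, d x, inv (e11 x) \<otimes> e12 x, inv (d x) \<otimes> e21 x)) \<in>
      {x \<in> carrier G. e11 x \<in> Units R \<and> inv (e11 x) \<otimes> e12 x \<in> B} \<rightarrow> Units R \<times> Units R \<times> B \<times> carrier R"
      by (auto simp: d_def GL2_carrier elim!: M2_cases)
  next
    fix p assume "p \<in> Units R \<times> Units R \<times> B \<times> carrier R"
    then obtain s\<^sub>1 s\<^sub>2 b c where p: "p = (s\<^sub>1, s\<^sub>2, b, c)" "s\<^sub>1 \<in> Units R" "s\<^sub>2 \<in> Units R" "b \<in> carrier R" "c \<in> carrier R"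
      using B by auto
    have c: "s\<^sub>1 \<in> carrier R" "s\<^sub>2 \<in> carrier R" using p by auto
    have "det2 R (Mat2 s\<^sub>1 (s\<^sub>1 \<otimes> b) (s\<^sub>2 \<otimes> c) (s\<^sub>2 \<otimes> (\<one> \<oplus> b \<otimes> c))) = s\<^sub>1 \<otimes> s\<^sub>2"
      unfolding det2_def mat2.sel using c p(4,5) by algebra
    hence "d (Mat2 s\<^sub>1 (s\<^sub>1 \<otimes> b) (s\<^sub>2 \<otimes> c) (s\<^sub>2 \<otimes> (\<one> \<oplus> b \<otimes> c))) = s\<^sub>2"
      using p c by (simp add: d_def inv_mult)
    thus "(\<lambda>x. (e11 x, d x, inv (e11 x) \<otimes> e12 x, inv (d x) \<otimes> e21 x))
      ((\<lambda>(s\<^sub>1, s\<^sub>2, b, c). Mat2 s\<^sub>1 \<zero> \<zero> s\<^sub>2 \<otimes>\<^bsub>G\<^esub> shear b c) p) = p"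
      using p c by (simp add: diag_mult_shear inv_mult del: GL2_mult)
  next
    fix x assume "x \<in> {x \<in> carrier G. e11 x \<in> Units R \<and> inv (e11 x) \<otimes> e12 x \<in> B}"
    then obtain a b c e where x: "x = Mat2 a b c e" "a \<in> Units R" "b \<in> carrier R" "c \<in> carrier R"
      "e \<in> carrier R" "det2 R x \<in> Units R"
      by (auto simp: GL2_carrier elim!: M2_cases)
    have dx: "d x \<in> Units R" "a \<otimes> d x = a \<otimes> e \<ominus> b \<otimes> c"
      using x mult_inv[of a "det2 R x"] by (auto simp: d_def det2_def)
    have cr: "a \<in> carrier R" "inv a \<in> carrier R" "d x \<in> carrier R" "inv (d x) \<in> carrier R" using x dx by auto
    have "inv a \<otimes> (a \<otimes> d x \<oplus> b \<otimes> c) = d x \<oplus> inv a \<otimes> (b \<otimes> c)"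
      using cr x inv_mult[of a "d x"] by (simp add: r_distr)
    moreover have "a \<otimes> d x \<oplus> b \<otimes> c = a \<otimes> e" unfolding dx(2) using cr(1) x(3-5) by algebra
    ultimately have e: "d x \<oplus> inv a \<otimes> (b \<otimes> c) = e" using inv_mult[of a e] x by simp
    have "d x \<otimes> (\<one> \<oplus> (inv a \<otimes> b) \<otimes> (inv (d x) \<otimes> c)) = d x \<oplus> (d x \<otimes> inv (d x)) \<otimes> (inv a \<otimes> (b \<otimes> c))"
      using cr x(3,4) by algebra
    also have "\<dots> = e" using e cr dx(1) x by simp
    finally show "(\<lambda>(s\<^sub>1, s\<^sub>2, b, c). Mat2 s\<^sub>1 \<zero> \<zero> s\<^sub>2 \<otimes>\<^bsub>G\<^esub> shear b c)
      (e11 x, d x, inv (e11 x) \<otimes> e12 x, inv (d x) \<otimes> e21 x) = x"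
      unfolding prod.case using x cr dx(1) by (subst diag_mult_shear) (auto simp: mult_inv)
  qed
qed

lemma sum_conj_term_diag_shear:
  assumes B: "B \<subseteq> carrier R" and g: "g \<in> carrier G"
  shows "(\<Sum>x | x \<in> carrier G \<and> e11 x \<in> Units R \<and> inv (e11 x) \<otimes> e12 x \<in> B. conj_term G T \<chi> g x) =
    of_nat (card (Units R) ^ 2) * (\<Sum>b\<in>B. \<Sum>c\<in>carrier R. conj_term G T \<chi> g (shear b c))"
proof -
  have "(\<Sum>x | x \<in> carrier G \<and> e11 x \<in> Units R \<and> inv (e11 x) \<otimes> e12 x \<in> B. conj_term G T \<chi> g x) =
    (\<Sum>(s\<^sub>1, s\<^sub>2, b, c)\<in>Units R \<times> Units R \<times> B \<times> carrier R.
      conj_term G T \<chi> g (Mat2 s\<^sub>1 \<zero> \<zero> s\<^sub>2 \<otimes>\<^bsub>G\<^esub> shear b c))"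
    by (subst sum.reindex_bij_betw[OF bij_betw_diag_shear[OF B], symmetric]) (simp add: case_prod_unfold)
  also have "\<dots> = (\<Sum>(s\<^sub>1, s\<^sub>2, b, c)\<in>Units R \<times> Units R \<times> B \<times> carrier R. conj_term G T \<chi> g (shear b c))"
  proof (rule sum.cong[OF refl], clarify)
    fix s\<^sub>1 s\<^sub>2 b c assume *: "s\<^sub>1 \<in> Units R" "s\<^sub>2 \<in> Units R" "b \<in> B" "c \<in> carrier R"
    show "conj_term G T \<chi> g (Mat2 s\<^sub>1 \<zero> \<zero> s\<^sub>2 \<otimes>\<^bsub>G\<^esub> shear b c) = conj_term G T \<chi> g (shear b c)"
    proof (rule G.conj_term_left_mult[OF T_subgroup T_mult(2)])
      show "\<chi> \<one>\<^bsub>G\<^esub> = 1" by (simp add: GL2_one box_char_def char_one)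
    qed (use * B g in \<open>auto simp: Mat2_in_T_iff intro: shear_in_GL2\<close>)
  qed
  also have "\<dots> = of_nat (card (Units R) ^ 2) * (\<Sum>b\<in>B. \<Sum>c\<in>carrier R. conj_term G T \<chi> g (shear b c))"
    by (simp add: sum.cartesian_product[symmetric] power2_eq_square mult.assoc)
  finally show ?thesis .
qed

end

context split_couple
begin

lemma conj_shear:
  assumes \<alpha>\<delta>: "\<alpha> \<in> carrier R" "\<delta> \<in> carrier R" and bc: "b \<in> carrier R" "c \<in> carrier R"
  shows "shear b c \<otimes>\<^bsub>G\<^esub> Mat2 \<alpha> \<zero> \<zero> \<delta> \<otimes>\<^bsub>G\<^esub> inv\<^bsub>G\<^esub> shear b c =
    Mat2 (\<alpha> \<oplus> (\<alpha> \<ominus> \<delta>) \<otimes> b \<otimes> c) (\<ominus> ((\<alpha> \<ominus> \<delta>) \<otimes> b))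
      ((\<alpha> \<ominus> \<delta>) \<otimes> (c \<otimes> (\<one> \<oplus> b \<otimes> c))) (\<delta> \<ominus> (\<alpha> \<ominus> \<delta>) \<otimes> b \<otimes> c)"
proof -
  define y where "y = Mat2 (\<one> \<oplus> b \<otimes> c) (\<ominus> b) (\<ominus> c) \<one>"
  have "(\<one> \<oplus> b \<otimes> c) \<otimes> \<one> \<ominus> \<ominus> b \<otimes> \<ominus> c = \<one>" using bc by algebra
  hence yG: "y \<in> carrier G" unfolding y_def Mat2_in_GL2 using bc by simp
  have "y \<otimes>\<^bsub>G\<^esub> shear b c = \<one>\<^bsub>G\<^esub>"
    unfolding y_def shear_def GL2_mult Mat2_mult GL2_one mat2.inject using bc by (intro conjI; algebra)
  hence inv: "inv\<^bsub>G\<^esub> shear b c = y" using yG shear_in_GL2[OF bc] by (intro G.inv_equality)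
  show ?thesis unfolding inv unfolding y_def shear_def GL2_mult Mat2_mult mat2.inject
    using \<alpha>\<delta> bc by (intro conjI; algebra)
qed

context
  fixes i :: nat and \<alpha> \<delta> :: 'a
  assumes i: "i < r" and \<alpha>: "\<alpha> \<in> Units R" and \<delta>: "\<delta> \<in> Units R"
    and diff: "\<exists>u\<in>Units R. \<alpha> \<ominus> \<delta> = t [^] i \<otimes> u"
begin

lemma diff_mult_in_pow_ideal_iff:
  assumes x: "x \<in> carrier R" and k: "k \<le> r"
  shows "(\<alpha> \<ominus> \<delta>) \<otimes> x \<in> pow_ideal k \<longleftrightarrow> x \<in> pow_ideal (k - i)"
proof -
  obtain u where u: "u \<in> Units R" "\<alpha> \<ominus> \<delta> = t [^] i \<otimes> u" using diff by blast
  have "(\<alpha> \<ominus> \<delta>) \<otimes> x = t [^] i \<otimes> (u \<otimes> x)" unfolding u using u(1) x by (intro m_assoc) auto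
  thus ?thesis using pow_mult_in_pow_ideal_iff[of "u \<otimes> x" k i] unit_mult_in_pow_ideal_iff[OF u(1) x] u(1) x k
    by auto
qed

lemma diff_in_pow_ideal: "\<alpha> \<ominus> \<delta> \<in> pow_ideal i"
  using diff pow_idealI by auto

lemma diff_mult_mem:
  assumes "b \<in> pow_ideal (l - i)" "c \<in> pow_ideal (l - i)"
  shows "(\<alpha> \<ominus> \<delta>) \<otimes> b \<otimes> c \<in> pow_ideal l" "(\<alpha> \<ominus> \<delta>) \<otimes> b \<otimes> c \<in> pow_ideal 1"
proof -
  have *: "(\<alpha> \<ominus> \<delta>) \<otimes> b \<otimes> c \<in> pow_ideal (i + (l - i) + (l - i))"
    by (intro pow_ideal_mult assms diff_in_pow_ideal)
  show "(\<alpha> \<ominus> \<delta>) \<otimes> b \<otimes> c \<in> pow_ideal l" by (rule pow_ideal_antimono[OF _ *]) simp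
  show "(\<alpha> \<ominus> \<delta>) \<otimes> b \<otimes> c \<in> pow_ideal 1" by (rule pow_ideal_antimono[OF _ *]) (use l_pos in simp)
qed

text \<open>
  The off-diagonal entries of the conjugate are \<open>- \<epsilon> b\<close> and \<open>\<epsilon> c (1 + b c)\<close> with \<open>\<epsilon> = \<alpha> - \<delta>\<close> of
  valuation \<open>i\<close>. For \<open>i < l\<close> the condition on \<open>b\<close> makes \<open>1 + b c\<close> a unit; for \<open>i \<ge> l\<close> both
  conditions are empty, in agreement with \<open>l - i = 0\<close>.
\<close>

lemma conj_term_shear:
  assumes bc: "b \<in> carrier R" "c \<in> carrier R"
  shows "conj_term G T \<chi> (Mat2 \<alpha> \<zero> \<zero> \<delta>) (shear b c) =
    (if b \<in> pow_ideal (l - i) \<and> c \<in> pow_ideal (l - i)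
     then \<mu> (\<alpha> \<oplus> (\<alpha> \<ominus> \<delta>) \<otimes> b \<otimes> c) * \<mu>' (\<delta> \<ominus> (\<alpha> \<ominus> \<delta>) \<otimes> b \<otimes> c) else 0)"
proof -
  have c: "\<alpha> \<in> carrier R" "\<delta> \<in> carrier R" using \<alpha> \<delta> by auto
  define w where "w = (\<alpha> \<ominus> \<delta>) \<otimes> b \<otimes> c"
  have b': "\<ominus> ((\<alpha> \<ominus> \<delta>) \<otimes> b) \<in> pow_ideal l \<longleftrightarrow> b \<in> pow_ideal (l - i)"
    using diff_mult_in_pow_ideal_iff[OF bc(1), of l] pow_ideal_minus[of "(\<alpha> \<ominus> \<delta>) \<otimes> b" l]
      pow_ideal_minus[of "\<ominus> ((\<alpha> \<ominus> \<delta>) \<otimes> b)" l] r_eq c bc by auto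
  have c': "(\<alpha> \<ominus> \<delta>) \<otimes> (c \<otimes> (\<one> \<oplus> b \<otimes> c)) \<in> pow_ideal l \<longleftrightarrow> c \<in> pow_ideal (l - i)"
    if b: "b \<in> pow_ideal (l - i)"
  proof -
    have "c \<otimes> (\<one> \<oplus> b \<otimes> c) \<in> pow_ideal (l - i) \<longleftrightarrow> c \<in> pow_ideal (l - i)"
    proof (cases "i < l")
      case True
      have "b \<otimes> c \<in> pow_ideal 1"
        using pow_ideal_antimono[of 1 "l - i" b] b True bc by (intro pow_ideal_mult_right) auto
      hence "\<one> \<oplus> b \<otimes> c \<in> Units R" by (intro unit_add_nonunit) auto
      thus ?thesis using unit_mult_in_pow_ideal_iff[of "\<one> \<oplus> b \<otimes> c" c] bc by (simp add: m_comm)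
    qed (use bc in simp)
    thus ?thesis using diff_mult_in_pow_ideal_iff[of "c \<otimes> (\<one> \<oplus> b \<otimes> c)" l] bc r_eq by simp
  qed
  have u: "\<alpha> \<oplus> w \<in> Units R" "\<delta> \<ominus> w \<in> Units R" if "b \<in> pow_ideal (l - i)" "c \<in> pow_ideal (l - i)"
    using unit_add_nonunit[OF \<alpha>, of w] unit_add_nonunit[OF \<delta>, of "\<ominus> w"] pow_ideal_minus[of w 1]
      diff_mult_mem[OF that] by (auto simp: w_def minus_eq)
  show ?thesis
    unfolding conj_term_def conj_shear[OF c bc] Mat2_in_T_iff w_def[symmetric]
    using u b' c' by (auto simp: box_char_def)
qed

text \<open>
  \<open>(\<alpha> + w) (\<alpha> + w')\<close> and \<open>\<alpha> (\<alpha> + w + w')\<close> differ by \<open>w w' = 0\<close>.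
\<close>

lemma char_pair_additive:
  assumes w: "w \<in> pow_ideal l" and w': "w' \<in> pow_ideal l"
  shows "\<mu> (\<alpha> \<oplus> (w \<oplus> w')) * \<mu>' (\<delta> \<ominus> (w \<oplus> w')) * (\<mu> \<alpha> * \<mu>' \<delta>) =
    \<mu> (\<alpha> \<oplus> w) * \<mu>' (\<delta> \<ominus> w) * (\<mu> (\<alpha> \<oplus> w') * \<mu>' (\<delta> \<ominus> w'))"
proof -
  have c: "\<alpha> \<in> carrier R" "\<delta> \<in> carrier R" "w \<in> carrier R" "w' \<in> carrier R"
    using \<alpha> \<delta> w w' pow_ideal_closed by auto
  have unit: "s \<oplus> x \<in> Units R" "s \<ominus> x \<in> Units R" if "s \<in> Units R" "x \<in> pow_ideal l" for s x
    using that unit_add_nonunit pow_ideal_antimono[of 1 l] pow_ideal_minus l_pos by (auto simp: minus_eq)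
  have s: "w \<oplus> w' \<in> pow_ideal l" using w w' pow_ideal_add by auto
  have z: "w \<otimes> w' = \<zero>" using w w' pow_ideal_l_mult by auto
  have "(\<alpha> \<oplus> w) \<otimes> (\<alpha> \<oplus> w') = (\<alpha> \<oplus> (w \<oplus> w')) \<otimes> \<alpha> \<oplus> w \<otimes> w'" using c by algebra
  hence "(\<alpha> \<oplus> w) \<otimes> (\<alpha> \<oplus> w') = (\<alpha> \<oplus> (w \<oplus> w')) \<otimes> \<alpha>" using z c by simp
  hence 1: "\<mu> (\<alpha> \<oplus> w) * \<mu> (\<alpha> \<oplus> w') = \<mu> (\<alpha> \<oplus> (w \<oplus> w')) * \<mu> \<alpha>"
    using unit \<alpha> w w' s by (metis char_mult(1))
  have "(\<delta> \<ominus> w) \<otimes> (\<delta> \<ominus> w') = (\<delta> \<ominus> (w \<oplus> w')) \<otimes> \<delta> \<oplus> w \<otimes> w'" using c by algebra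
  hence "(\<delta> \<ominus> w) \<otimes> (\<delta> \<ominus> w') = (\<delta> \<ominus> (w \<oplus> w')) \<otimes> \<delta>" using z c by simp
  hence "\<mu>' (\<delta> \<ominus> w) * \<mu>' (\<delta> \<ominus> w') = \<mu>' (\<delta> \<ominus> (w \<oplus> w')) * \<mu>' \<delta>"
    using unit \<delta> w w' s by (metis char_mult(2))
  with 1 show ?thesis by (simp add: ac_simps)
qed

text \<open>
  Regularity provides \<open>z\<close> in the minimal ideal with \<open>\<mu> (1 + z) \<noteq> \<mu>' (1 + z)\<close>, and \<open>\<alpha> z\<close> is the
  witness. For \<open>i > 0\<close> the elements \<open>\<alpha>\<close> and \<open>\<delta>\<close> agree modulo \<open>t\<close>, hence \<open>\<alpha> z = \<delta> z\<close> and
  \<open>\<delta> - \<alpha> z = \<delta> (1 - z)\<close>, while \<open>z\<^sup>2 = 0\<close> makes \<open>1 - z\<close> inverse to \<open>1 + z\<close>.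
\<close>

lemma char_pair_nontrivial:
  assumes i0: "0 < i"
  obtains z where "z \<in> pow_ideal (r - 1)" "\<mu> (\<alpha> \<oplus> z) * \<mu>' (\<delta> \<ominus> z) \<noteq> \<mu> \<alpha> * \<mu>' \<delta>"
proof -
  have r2: "2 * (r - 1) \<ge> r" using r_eq l_pos by simp
  obtain y where y: "y \<in> carrier R" and ne: "\<mu> (\<one> \<oplus> t [^] (r - 1) \<otimes> y) * inverse (\<mu>' (\<one> \<oplus> t [^] (r - 1) \<otimes> y)) \<noteq> 1"
    using regular unfolding regular_couple_def by auto
  define z where "z = t [^] (r - 1) \<otimes> y"
  have zi: "z \<in> pow_ideal (r - 1)" unfolding z_def using y by (rule pow_idealI)
  have z1: "z \<in> pow_ideal 1" by (rule pow_ideal_antimono[OF _ zi]) (use r_eq l_pos in simp)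
  have c: "\<alpha> \<in> carrier R" "\<delta> \<in> carrier R" "z \<in> carrier R" using \<alpha> \<delta> zi pow_ideal_closed by auto
  have u: "\<one> \<oplus> z \<in> Units R" "\<one> \<ominus> z \<in> Units R"
    using unit_add_nonunit[of \<one>] z1 pow_ideal_minus[OF z1] by (auto simp: minus_eq)
  have "z \<otimes> z = \<zero>" using pow_ideal_trivial[OF pow_ideal_mult[OF zi zi]] r2 by simp
  moreover have "(\<one> \<oplus> z) \<otimes> (\<one> \<ominus> z) = \<one> \<ominus> z \<otimes> z" using c(3) by algebra
  ultimately have "\<mu>' (\<one> \<oplus> z) * \<mu>' (\<one> \<ominus> z) = 1"
    using u char_mult(2)[of "\<one> \<oplus> z" "\<one> \<ominus> z"] char_one by (simp add: minus_eq)
  hence inv: "\<mu>' (\<one> \<ominus> z) = inverse (\<mu>' (\<one> \<oplus> z))" by (metis inverse_unique)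
  have "(\<alpha> \<ominus> \<delta>) \<otimes> z = \<zero>"
    using pow_ideal_trivial[OF pow_ideal_mult[OF diff_in_pow_ideal zi]] i0 by simp
  moreover have "\<delta> \<ominus> \<alpha> \<otimes> z = \<delta> \<otimes> (\<one> \<ominus> z) \<ominus> (\<alpha> \<ominus> \<delta>) \<otimes> z" using c by algebra
  ultimately have 2: "\<delta> \<ominus> \<alpha> \<otimes> z = \<delta> \<otimes> (\<one> \<ominus> z)" using c by (simp add: minus_eq)
  have 1: "\<alpha> \<oplus> \<alpha> \<otimes> z = \<alpha> \<otimes> (\<one> \<oplus> z)" using c by algebra
  have "\<mu> (\<alpha> \<oplus> \<alpha> \<otimes> z) * \<mu>' (\<delta> \<ominus> \<alpha> \<otimes> z) = \<mu> \<alpha> * \<mu>' \<delta> * (\<mu> (\<one> \<oplus> z) * inverse (\<mu>' (\<one> \<oplus> z)))"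
    unfolding 1 2 using u \<alpha> \<delta> by (simp add: char_mult inv)
  moreover have "\<mu> \<alpha> * \<mu>' \<delta> \<noteq> 0" using unit_char_nonzero[OF chars(1) \<alpha>] unit_char_nonzero[OF chars(2) \<delta>] by simp
  ultimately have "\<mu> (\<alpha> \<oplus> \<alpha> \<otimes> z) * \<mu>' (\<delta> \<ominus> \<alpha> \<otimes> z) \<noteq> \<mu> \<alpha> * \<mu>' \<delta>" using ne unfolding z_def by auto
  thus thesis using that[of "\<alpha> \<otimes> z"] pow_ideal_mult_left[OF c(1) zi] by blast
qed

text \<open>
  Orthogonality: the additive character sends \<open>c\<close> to the value at \<open>\<epsilon> b c\<close>. If \<open>b\<close> is divisible by
  \<open>t ^ (r - i - m)\<close>, with \<open>m = l - i\<close>, then \<open>\<epsilon> b c = 0\<close>. Otherwise \<open>\<epsilon> b t ^ m R\<close> contains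
  the minimal ideal, on which the character is nontrivial.
\<close>

lemma char_sum:
  assumes b: "b \<in> pow_ideal (l - i)"
  shows "(\<Sum>c\<in>pow_ideal (l - i). \<mu> (\<alpha> \<oplus> (\<alpha> \<ominus> \<delta>) \<otimes> b \<otimes> c) * \<mu>' (\<delta> \<ominus> (\<alpha> \<ominus> \<delta>) \<otimes> b \<otimes> c)) =
    (if b \<in> pow_ideal (r - i - (l - i)) then of_nat (q ^ (r - (l - i))) * (\<mu> \<alpha> * \<mu>' \<delta>) else 0)"
    (is "?S = _")
proof -
  define m where "m = l - i"
  define f where "f w = \<mu> (\<alpha> \<oplus> w) * \<mu>' (\<delta> \<ominus> w)" for w
  have ac: "\<alpha> \<in> carrier R" "\<delta> \<in> carrier R" "b \<in> carrier R" using \<alpha> \<delta> b pow_ideal_closed by auto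
  have f0: "f \<zero> = \<mu> \<alpha> * \<mu>' \<delta>" using ac by (simp add: f_def minus_eq)
  have m: "m \<le> r" "i + m \<le> r" using r_eq i by (auto simp: m_def)
  show ?thesis
  proof (cases "b \<in> pow_ideal (r - i - (l - i))")
    case True
    have "(\<alpha> \<ominus> \<delta>) \<otimes> b \<otimes> c = \<zero>" if "c \<in> pow_ideal m" for c
      using pow_ideal_trivial[OF pow_ideal_mult[OF pow_ideal_mult[OF diff_in_pow_ideal True] that]] m
      by (simp add: m_def)
    hence "?S = (\<Sum>c\<in>pow_ideal m. f \<zero>)" unfolding m_def[symmetric] f_def by (intro sum.cong) auto
    thus ?thesis using True card_pow_ideal[OF m(1)] f0 by (simp add: m_def)
  next
    case False
    then obtain j v where j: "j < r - i - m" and v: "v \<in> Units R" "b = t [^] j \<otimes> v"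
      using factor_outside_pow_ideal[OF ac(3)] m_def by metis
    \<comment> \<open>For \<open>i = 0\<close> the two ideals \<open>(t ^ m)\<close> and \<open>(t ^ (r - i - m))\<close> both equal \<open>(t ^ l)\<close>.\<close>
    have i0: "0 < i"
    proof (rule ccontr)
      assume "\<not> 0 < i"
      thus False using False b r_eq by simp
    qed
    obtain u where u: "u \<in> Units R" "\<alpha> \<ominus> \<delta> = t [^] i \<otimes> u" using diff by blast
    obtain z where z: "z \<in> pow_ideal (r - 1)" "f z \<noteq> f \<zero>"
      using char_pair_nontrivial[OF i0] f0 unfolding f_def by metis
    have "z \<in> pow_ideal (i + j + m)" by (rule pow_ideal_antimono[OF _ z(1)]) (use j in simp)
    then obtain y where y: "y \<in> carrier R" "z = t [^] (i + j + m) \<otimes> y" by (rule pow_idealE)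
    \<comment> \<open>Solves \<open>(\<alpha> - \<delta>) b c\<^sub>0 = z\<close>; translation by \<open>c\<^sub>0\<close> multiplies the sum by a factor other than \<open>1\<close>.\<close>
    define c0 where "c0 = t [^] m \<otimes> (inv u \<otimes> inv v \<otimes> y)"
    have c0: "c0 \<in> pow_ideal m" unfolding c0_def using u v y by (intro pow_idealI) auto
    have uc: "u \<in> carrier R" "v \<in> carrier R" "inv u \<in> carrier R" "inv v \<in> carrier R"
      and tc: "t [^] i \<in> carrier R" "t [^] j \<in> carrier R" "t [^] m \<in> carrier R" using u v by auto
    have "(\<alpha> \<ominus> \<delta>) \<otimes> b \<otimes> c0 = t [^] i \<otimes> t [^] j \<otimes> t [^] m \<otimes> ((u \<otimes> inv u) \<otimes> (v \<otimes> inv v) \<otimes> y)"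
      unfolding u(2) v(2) c0_def using uc tc y(1) by algebra
    also have "\<dots> = z" using u(1) v(1) y tc by (simp add: nat_pow_mult)
    finally have c0z: "(\<alpha> \<ominus> \<delta>) \<otimes> b \<otimes> c0 = z" .
    have shift: "bij_betw (\<lambda>c. c \<oplus> c0) (pow_ideal m) (pow_ideal m)"
    proof (rule bij_betwI[where g = "\<lambda>c. c \<ominus> c0"])
      fix c assume "c \<in> pow_ideal m"
      hence "c \<in> carrier R" "c0 \<in> carrier R" using c0 pow_ideal_closed by auto
      thus "c \<oplus> c0 \<ominus> c0 = c" "c \<ominus> c0 \<oplus> c0 = c" by algebra+
    qed (use c0 pow_ideal_add pow_ideal_minus in \<open>auto simp: minus_eq\<close>)
    have S: "?S = (\<Sum>c\<in>pow_ideal m. f ((\<alpha> \<ominus> \<delta>) \<otimes> b \<otimes> c))" by (simp add: f_def m_def)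
    have "?S * f \<zero> = (\<Sum>c\<in>pow_ideal m. f ((\<alpha> \<ominus> \<delta>) \<otimes> b \<otimes> (c \<oplus> c0)) * f \<zero>)"
      unfolding S by (subst sum.reindex_bij_betw[OF shift, symmetric]) (simp add: sum_distrib_right)
    also have "\<dots> = (\<Sum>c\<in>pow_ideal m. f ((\<alpha> \<ominus> \<delta>) \<otimes> b \<otimes> c) * f z)"
    proof (rule sum.cong[OF refl])
      fix c assume c: "c \<in> pow_ideal m"
      hence "(\<alpha> \<ominus> \<delta>) \<otimes> b \<otimes> (c \<oplus> c0) = (\<alpha> \<ominus> \<delta>) \<otimes> b \<otimes> c \<oplus> (\<alpha> \<ominus> \<delta>) \<otimes> b \<otimes> c0"
        using c0 ac pow_ideal_closed by (intro r_distr) auto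
      thus "f ((\<alpha> \<ominus> \<delta>) \<otimes> b \<otimes> (c \<oplus> c0)) * f \<zero> = f ((\<alpha> \<ominus> \<delta>) \<otimes> b \<otimes> c) * f z"
        using char_pair_additive[of "(\<alpha> \<ominus> \<delta>) \<otimes> b \<otimes> c" "(\<alpha> \<ominus> \<delta>) \<otimes> b \<otimes> c0"]
          diff_mult_mem[OF b, of c] diff_mult_mem[OF b, of c0] c c0 f0
        unfolding c0z f_def m_def by simp
    qed
    also have "\<dots> = ?S * f z" unfolding S by (simp add: sum_distrib_right)
    finally have "?S = 0" using z(2) by simp
    thus ?thesis using False by simp
  qed
qed

text \<open>
  Only \<open>b\<close> in \<open>(t ^ (r - i - m))\<close>, where \<open>m = l - i\<close>, contributes. This ideal is contained in the maximal
  ideal, so the value is the same for every \<open>B\<close> between the maximal ideal and \<open>R\<close>.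
\<close>

lemma sum_conj_term_shear:
  assumes B: "pow_ideal 1 \<subseteq> B" "B \<subseteq> carrier R"
  shows "(\<Sum>b\<in>B. \<Sum>c\<in>carrier R. conj_term G T \<chi> (Mat2 \<alpha> \<zero> \<zero> \<delta>) (shear b c)) =
    of_nat (q ^ (r + i)) * (\<mu> \<alpha> * \<mu>' \<delta>)"
proof -
  define m where "m = l - i"
  define n where "n = r - i - m"
  define f where "f w = \<mu> (\<alpha> \<oplus> w) * \<mu>' (\<delta> \<ominus> w)" for w
  have m: "m \<le> r" "m \<le> n" "1 \<le> n" "n \<le> r" using r_eq i l_pos by (auto simp: m_def n_def)
  have finB: "finite B" using B finite_carrier finite_subset by auto
  have n_sub: "pow_ideal n \<subseteq> B \<inter> pow_ideal m" using m B pow_ideal_antimono by blast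
  have inner: "(\<Sum>c\<in>carrier R. conj_term G T \<chi> (Mat2 \<alpha> \<zero> \<zero> \<delta>) (shear b c)) =
      (if b \<in> pow_ideal n then of_nat (q ^ (r - m)) * (\<mu> \<alpha> * \<mu>' \<delta>) else 0)" if b: "b \<in> B" for b
  proof (cases "b \<in> pow_ideal m")
    case True
    have "(\<Sum>c\<in>carrier R. conj_term G T \<chi> (Mat2 \<alpha> \<zero> \<zero> \<delta>) (shear b c)) =
      (\<Sum>c\<in>carrier R. if c \<in> pow_ideal m then f ((\<alpha> \<ominus> \<delta>) \<otimes> b \<otimes> c) else 0)"
      using b B True by (intro sum.cong) (auto simp: conj_term_shear m_def f_def)
    also have "\<dots> = (\<Sum>c\<in>pow_ideal m. f ((\<alpha> \<ominus> \<delta>) \<otimes> b \<otimes> c))"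
      using finite_carrier pow_ideal_closed by (subst sum.inter_restrict[symmetric]) (auto intro!: sum.cong)
    finally show ?thesis using char_sum[of b] True by (simp add: m_def n_def f_def)
  next
    case False
    thus ?thesis using b B n_sub by (auto simp: conj_term_shear m_def intro!: sum.neutral)
  qed
  have "(\<Sum>b\<in>B. \<Sum>c\<in>carrier R. conj_term G T \<chi> (Mat2 \<alpha> \<zero> \<zero> \<delta>) (shear b c)) =
    (\<Sum>b\<in>B \<inter> pow_ideal n. of_nat (q ^ (r - m)) * (\<mu> \<alpha> * \<mu>' \<delta>))"
    using finB by (subst sum.inter_restrict) (auto simp: inner intro!: sum.cong)
  also have "B \<inter> pow_ideal n = pow_ideal n" using n_sub by blast
  also have "(\<Sum>b\<in>pow_ideal n. of_nat (q ^ (r - m)) * (\<mu> \<alpha> * \<mu>' \<delta>)) =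
    of_nat (q ^ (r - n) * q ^ (r - m)) * (\<mu> \<alpha> * \<mu>' \<delta>)"
    using card_pow_ideal[OF m(4)] by (simp add: mult.assoc)
  also have "q ^ (r - n) * q ^ (r - m) = q ^ (r + i)"
    using m i by (simp add: n_def flip: power_add) (metis diff_diff_left Nat.add_diff_assoc add.commute diff_diff_cancel le_add_diff_inverse2 add.left_commute)
  finally show ?thesis .
qed

end

theorem trace_at_diagonal:
  assumes i: "i < r" and \<alpha>: "\<alpha> \<in> Units R" and \<delta>: "\<delta> \<in> Units R"
    and diff: "\<exists>u\<in>Units R. \<alpha> \<ominus> \<delta> = t [^] i \<otimes> u"
  shows "ind_trace G T \<chi> (Mat2 \<alpha> \<zero> \<zero> \<delta>) = of_nat q ^ i * (\<mu> \<alpha> * \<mu>' \<delta> + \<mu>' \<alpha> * \<mu> \<delta>)"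
proof -
  define D where "D = Mat2 \<alpha> \<zero> \<zero> \<delta>"
  define D' where "D' = Mat2 \<delta> \<zero> \<zero> \<alpha>"
  define w where "w = Mat2 \<zero> \<one> \<one> \<zero>"
  define U where "U = card (Units R)"
  have c: "\<alpha> \<in> carrier R" "\<delta> \<in> carrier R" using \<alpha> \<delta> by auto
  have DG: "D \<in> carrier G" "D' \<in> carrier G" using T_subset Mat2_in_T_iff \<alpha> \<delta> by (auto simp: D_def D'_def)
  have wG: "w \<in> carrier G" using Units_minus_one_closed by (simp add: w_def Mat2_in_GL2 minus_eq)
  have ww: "w \<otimes>\<^bsub>G\<^esub> w = \<one>\<^bsub>G\<^esub>" by (simp add: w_def GL2_one)
  hence "inv\<^bsub>G\<^esub> w = w" using wG by (intro G.inv_equality)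
  hence wDw: "w \<otimes>\<^bsub>G\<^esub> D \<otimes>\<^bsub>G\<^esub> inv\<^bsub>G\<^esub> w = D'" using c by (simp add: w_def D_def D'_def)
  have diff': "\<exists>u\<in>Units R. \<delta> \<ominus> \<alpha> = t [^] i \<otimes> u"
  proof -
    obtain u where u: "u \<in> Units R" "\<alpha> \<ominus> \<delta> = t [^] i \<otimes> u" using diff by blast
    have "\<delta> \<ominus> \<alpha> = \<ominus> (\<alpha> \<ominus> \<delta>)" using c by algebra
    also have "\<dots> = t [^] i \<otimes> \<ominus> u" using u by (simp add: r_minus Units_closed)
    finally show ?thesis using Units_minus_one_closed Units_m_closed[of "\<ominus> \<one>" u] u
      by (intro bexI[of _ "\<ominus> u"]) (auto simp: l_minus Units_closed)
  qed
  have unit_e11: "{x \<in> carrier G. e11 x \<in> Units R} =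
      {x \<in> carrier G. e11 x \<in> Units R \<and> inv (e11 x) \<otimes> e12 x \<in> carrier R}"
    by (auto simp: GL2_carrier elim!: M2_cases)
  \<comment> \<open>A nonunit in the upper right corner forces a unit in the upper left, by invertibility.\<close>
  have nonunit_e12: "{x \<in> carrier G. e12 x \<notin> Units R} =
      {x \<in> carrier G. e11 x \<in> Units R \<and> inv (e11 x) \<otimes> e12 x \<in> pow_ideal 1}" (is "?L = ?M")
  proof (intro equalityI subsetI)
    fix x assume "x \<in> ?L"
    then obtain a b d e where x: "x = Mat2 a b d e" "a \<in> carrier R" "b \<in> carrier R" "d \<in> carrier R"
      "e \<in> carrier R" "a \<otimes> e \<ominus> b \<otimes> d \<in> Units R" "b \<notin> Units R" and xG: "x \<in> carrier G"
      by (auto simp: GL2_carrier det2_def elim!: M2_cases)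
    have b: "b \<in> pow_ideal 1" using x nonunit_iff by auto
    have "(a \<otimes> e \<ominus> b \<otimes> d) \<oplus> b \<otimes> d \<in> Units R"
      using x b by (intro unit_add_nonunit pow_ideal_mult_right)
    moreover have "(a \<otimes> e \<ominus> b \<otimes> d) \<oplus> b \<otimes> d = a \<otimes> e" using x(2-5) by algebra
    ultimately have "a \<in> Units R" using unit_factor[of a e] x by simp
    thus "x \<in> ?M" using xG x b by (auto intro: pow_ideal_mult_left)
  next
    fix x assume "x \<in> ?M"
    then obtain a b d e where x: "x = Mat2 a b d e" "a \<in> Units R" "b \<in> carrier R"
      "inv a \<otimes> b \<in> pow_ideal 1" and xG: "x \<in> carrier G"
      by (auto simp: GL2_carrier elim!: M2_cases)
    have "b \<notin> Units R" using nonunit_iff[of b] unit_mult_in_pow_ideal_iff[of "inv a" b 1] x by auto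
    thus "x \<in> ?L" using x xG by simp
  qed
  have swap: "bij_betw (\<lambda>x. x \<otimes>\<^bsub>G\<^esub> w) {x \<in> carrier G. e12 x \<notin> Units R} {x \<in> carrier G. e11 x \<notin> Units R}"
  proof (rule bij_betwI[where g = "\<lambda>x. x \<otimes>\<^bsub>G\<^esub> w"])
    have e: "e11 (x \<otimes>\<^bsub>G\<^esub> w) = e12 x" "e12 (x \<otimes>\<^bsub>G\<^esub> w) = e11 x" if "x \<in> carrier G" for x
      using that by (auto simp: w_def GL2_carrier elim!: M2_cases)
    show "(\<lambda>x. x \<otimes>\<^bsub>G\<^esub> w) \<in> {x \<in> carrier G. e12 x \<notin> Units R} \<rightarrow> {x \<in> carrier G. e11 x \<notin> Units R}"
      "(\<lambda>x. x \<otimes>\<^bsub>G\<^esub> w) \<in> {x \<in> carrier G. e11 x \<notin> Units R} \<rightarrow> {x \<in> carrier G. e12 x \<notin> Units R}"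
      using G.m_closed[OF _ wG] e by (auto simp del: GL2_mult)
  qed (use wG ww in \<open>simp_all add: G.m_assoc del: GL2_mult\<close>)
  have sum1: "(\<Sum>x\<in>{x \<in> carrier G. e11 x \<in> Units R}. conj_term G T \<chi> D x) =
      of_nat (U ^ 2) * (of_nat (q ^ (r + i)) * (\<mu> \<alpha> * \<mu>' \<delta>))"
    unfolding unit_e11 U_def using sum_conj_term_diag_shear[OF order.refl DG(1)]
      sum_conj_term_shear[OF i \<alpha> \<delta> diff _ order.refl] pow_ideal_closed by (auto simp: D_def)
  have sum2: "(\<Sum>x\<in>{x \<in> carrier G. e11 x \<notin> Units R}. conj_term G T \<chi> D x) =
      of_nat (U ^ 2) * (of_nat (q ^ (r + i)) * (\<mu> \<delta> * \<mu>' \<alpha>))"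
  proof -
    have "(\<Sum>x\<in>{x \<in> carrier G. e11 x \<notin> Units R}. conj_term G T \<chi> D x) =
      (\<Sum>x\<in>{x \<in> carrier G. e12 x \<notin> Units R}. conj_term G T \<chi> D (x \<otimes>\<^bsub>G\<^esub> w))"
      by (rule sum.reindex_bij_betw[OF swap, symmetric])
    also have "\<dots> = (\<Sum>x\<in>{x \<in> carrier G. e12 x \<notin> Units R}. conj_term G T \<chi> D' x)"
      using G.conj_term_right_mult[OF _ DG(1) wG, of _ T \<chi>] unfolding wDw by (intro sum.cong) auto
    also have "\<dots> = of_nat (U ^ 2) * (of_nat (q ^ (r + i)) * (\<mu> \<delta> * \<mu>' \<alpha>))"
      unfolding nonunit_e12 U_def using sum_conj_term_diag_shear[OF _ DG(2), of "pow_ideal 1"]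
        sum_conj_term_shear[OF i \<delta> \<alpha> diff' order.refl] pow_ideal_closed by (auto simp: D'_def)
    finally show ?thesis .
  qed
  have "of_nat (card T) * ind_trace G T \<chi> D =
      (\<Sum>x | x \<in> carrier G \<and> x \<otimes>\<^bsub>G\<^esub> D \<otimes>\<^bsub>G\<^esub> inv\<^bsub>G\<^esub> x \<in> T. \<chi> (x \<otimes>\<^bsub>G\<^esub> D \<otimes>\<^bsub>G\<^esub> inv\<^bsub>G\<^esub> x))"
    by (rule induced_trace_formula[OF GL2_group finite_GL2 T_subgroup T_mult(2) DG(1)])
  also have "\<dots> = (\<Sum>x\<in>carrier G. conj_term G T \<chi> D x)"
    unfolding conj_term_def using finite_GL2 by (subst sum.inter_filter[symmetric]) auto
  also have "\<dots> = (\<Sum>x\<in>{x \<in> carrier G. e11 x \<in> Units R}. conj_term G T \<chi> D x) +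
      (\<Sum>x\<in>{x \<in> carrier G. e11 x \<notin> Units R}. conj_term G T \<chi> D x)"
    using finite_GL2 by (subst sum.union_disjoint[symmetric]) (auto intro!: sum.cong)
  also have "\<dots> = of_nat (card T) * (of_nat q ^ i * (\<mu> \<alpha> * \<mu>' \<delta> + \<mu>' \<alpha> * \<mu> \<delta>))"
    unfolding sum1 sum2 card_T U_def by (simp add: power_add algebra_simps)
  finally have "of_nat (card T) * ind_trace G T \<chi> D =
      of_nat (card T) * (of_nat q ^ i * (\<mu> \<alpha> * \<mu>' \<delta> + \<mu>' \<alpha> * \<mu> \<delta>))" .
  moreover have "finite (Units R)" using finite_carrier by blast
  hence "card T \<noteq> 0" unfolding card_T using q_pos Units_one_closed by auto
  ultimately show ?thesis by (simp add: D_def)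
qed

end

section \<open>Diagonal elements of GL(2) over a truncated ring of integers\<close>

theorem proposition9:
  fixes F :: "('a, 'b) ring_scheme" and v :: "'a \<Rightarrow> int" and \<pi> :: 'a
    and R :: "'a set ring" and t :: "'a set"
    and q p r i :: nat
    and \<mu> \<mu>' :: "'a set \<Rightarrow> complex" and \<alpha> \<delta> :: "'a set"
  assumes "nonarch_local_field F v"
    and "uniformizer F v \<pi>"
    and "q = card (carrier (residue_field F v))"
    and "p = ring_char (residue_field F v)" and "p \<noteq> 2"
    and "2 \<le> r" and "even r"
    and "R = trunc_ring F v \<pi> r"
    and "t = trunc_pi F v \<pi> r"
    and "regular_couple R t r \<mu> \<mu>'"
    and "0 \<le> i" and "i \<le> r - 1"
    and "\<alpha> \<in> Units R" and "\<delta> \<in> Units R"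
    and "\<alpha> \<ominus>\<^bsub>R\<^esub> \<delta> \<in> {t [^]\<^bsub>R\<^esub> i \<otimes>\<^bsub>R\<^esub> u | u. u \<in> Units R}"
  shows "principal_split_trace R t r \<mu> \<mu>' (Mat2 \<alpha> \<zero>\<^bsub>R\<^esub> \<zero>\<^bsub>R\<^esub> \<delta>)
    = of_nat q ^ i * (\<mu> \<alpha> * \<mu>' \<delta> + \<mu>' \<alpha> * \<mu> \<delta>)"
proof -
  interpret chain_ring R t r q
    using nonarch_local_field.trunc_ring_chain_ring[OF assms(1,2)] assms(3,6,8,9) by simp
  interpret split_couple R t r q \<mu> \<mu>' "r div 2"
    by unfold_locales (use assms in auto)
  show ?thesis unfolding principal_split_trace_def
    by (rule trace_at_diagonal) (use assms in auto)
qed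

end
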